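(* Let $\Omega\subset\mathbb{H}$ be a symmetric slice domain such that $\Omega_{I_0}=\Omega\cap\mathbb{C}_{I_0}$ is simply connected for some (and then any) $I_0\in\mathbb{S}$. Let $f\in\mathcal{S}(\Omega)\setminus\{0\}$ have no non-real isolated zeroes, and let $m\in\mathbb{N}$ be the multiplicity of $f$ at $0$. Then there exist $\mathcal{R},\mathcal{T}\in\mathcal{S}_{\mathbb{R}}(\Omega)$ and $h\in\mathcal{S}(\Omega)$, with $h$ never vanishing, such that $$f(q)=q^{m}\,\mathcal{R}(q)\,\mathcal{T}(q)\,h(q),$$ where $\mathcal{R}$ vanishes exactly at the real non-vanishing (i.e. different from $0$) zeroes of $f$, and $\mathcal{T}$ vanishes exactly at the spherical zeroes of $f$.
   Context: $\mathbb{H}$ is the algebra of quaternions with standard basis $1,i,j,k$, $\mathbb{S}=\{q\in\mathbb{H}: q^2=-1\}$, and $\mathbb{C}_I=\mathrm{Span}_{\mathbb{R}}(1,I)$ for $I\in\mathbb{S}$. A symmetric slice domain $\Omega\subset\mathbb{H}$ is a domain (connected open set) such that $\Omega\cap\mathbb{R}\neq\emptyset$ and, whenever $\alpha+I\beta\in\Omega$ ($\alpha,\beta\in\mathbb{R}$, $I\in\mathbb{S}$), the whole set $\mathbb{S}_{\alpha+I\beta}=\{\alpha+J\beta: J\in\mathbb{S}\}$ is contained in $\Omega$. A function $f:\Omega\to\mathbb{H}$ is slice regular if for every $J\in\mathbb{S}$ the restriction $f_J$ of $f$ to $\Omega\cap\mathbb{C}_J$ is holomorphic: $\frac12\left(\frac{\partial}{\partial\alpha}+J\frac{\partial}{\partial\beta}\right)f_J(\alpha+J\beta)\equiv0$.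 $\mathcal{S}(\Omega)$ is the set of slice regular functions on $\Omega$; $\mathcal{S}_{\mathbb{R}}(\Omega)$ is the subset of slice preserving functions, i.e. $f(\Omega\cap\mathbb{C}_I)\subset\mathbb{C}_I$ for all $I\in\mathbb{S}$. Known fact: every $f\in\mathcal{S}(\Omega)$ is written uniquely as $f=f_0+f_1i+f_2j+f_3k$ with $f_0,\dots,f_3\in\mathcal{S}_{\mathbb{R}}(\Omega)$. The $*$-product is $f*g=f_0g_0-f_1g_1-f_2g_2-f_3g_3+f_0(g_1i+g_2j+g_3k)+g_0(f_1i+f_2j+f_3k)+(f_2g_3-f_3g_2)i+(f_3g_1-f_1g_3)j+(f_1g_2-f_2g_1)k$. Multiplicities: for $f\in\mathcal{S}(\Omega)\setminus\{0\}$ and $\mathbb{S}_{\alpha+I\beta}\subset\Omega$ with $\beta\neq0$, there are $\mu,n\in\mathbb{N}$ (possibly $0$) and $p_1,\dots,p_n\in\mathbb{S}_{\alpha+I\beta}$ with $p_\nu\neq p_{\nu+1}^c$ (quaternionic conjugate) for all $\nu=1,\dots,n-1$, such that $f(q)=[(q-\alpha)^2+\beta^2]^{\mu}(q-p_1)*\dots*(q-p_n)*g(q)$ with $g\in\mathcal{S}(\Omega)$ having no zeros in $\mathbb{S}_{\alpha+I\beta}$; $2\mu$ is the spherical multiplicity of $\mathbb{S}_{\alpha+I\beta}$ and $n$ is the isolated multiplicity of $p_1$. The sphere $\mathbb{S}_{\alpha+I\beta}$ is a spherical zero of $f$ if $\mu\geq1$ (equivalently $f$ vanishes on all of it). "$f$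 has no non-real isolated zeroes" means that no non-real point has positive isolated multiplicity, i.e. $n=0$ for every such sphere. The multiplicity of $f$ at a real point $x\in\Omega$ is the $m\in\mathbb{N}$ with $f(q)=(q-x)^m h(q)$, $h\in\mathcal{S}(\Omega)$, $h(x)\neq0$ ($m=0$ if $f(x)\ne0$; if $0\notin\Omega$ the multiplicity at $0$ is understood to be $0$). *)

theory Defs
  imports "HOL-Analysis.Analysis"
begin

section \<open>Quaternions\<close>

datatype quat = Quat (qRe: real) (qIm1: real) (qIm2: real) (qIm3: real)

lemma quat_eq_iff:
  "p = q \<longleftrightarrow> qRe p = qRe q \<and> qIm1 p = qIm1 q \<and> qIm2 p = qIm2 q \<and> qIm3 p = qIm3 q"
  by (cases p; cases q) simp

instantiation quat :: real_vector
begin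

definition zero_quat :: quat where "0 = Quat 0 0 0 0"

definition plus_quat :: "quat \<Rightarrow> quat \<Rightarrow> quat" where
  "p + q = Quat (qRe p + qRe q) (qIm1 p + qIm1 q) (qIm2 p + qIm2 q) (qIm3 p + qIm3 q)"

definition uminus_quat :: "quat \<Rightarrow> quat" where
  "- q = Quat (- qRe q) (- qIm1 q) (- qIm2 q) (- qIm3 q)"

definition minus_quat :: "quat \<Rightarrow> quat \<Rightarrow> quat" where
  "p - q = Quat (qRe p - qRe q) (qIm1 p - qIm1 q) (qIm2 p - qIm2 q) (qIm3 p - qIm3 q)"

definition scaleR_quat :: "real \<Rightarrow> quat \<Rightarrow> quat" where
  "c *\<^sub>R q = Quat (c * qRe q) (c * qIm1 q) (c * qIm2 q) (c * qIm3 q)"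

lemma quat_add_simps [simp]:
  "qRe 0 = 0" "qIm1 0 = 0" "qIm2 0 = 0" "qIm3 0 = 0"
  "qRe (p + q) = qRe p + qRe q" "qIm1 (p + q) = qIm1 p + qIm1 q"
  "qIm2 (p + q) = qIm2 p + qIm2 q" "qIm3 (p + q) = qIm3 p + qIm3 q"
  "qRe (- q) = - qRe q" "qIm1 (- q) = - qIm1 q"
  "qIm2 (- q) = - qIm2 q" "qIm3 (- q) = - qIm3 q"
  "qRe (p - q) = qRe p - qRe q" "qIm1 (p - q) = qIm1 p - qIm1 q"
  "qIm2 (p - q) = qIm2 p - qIm2 q" "qIm3 (p - q) = qIm3 p - qIm3 q"
  "qRe (c *\<^sub>R q) = c * qRe q" "qIm1 (c *\<^sub>R q) = c * qIm1 q"
  "qIm2 (c *\<^sub>R q) = c * qIm2 q" "qIm3 (c *\<^sub>R q) = c * qIm3 q"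
  by (simp_all add: zero_quat_def plus_quat_def uminus_quat_def minus_quat_def scaleR_quat_def)

instance
  by standard (simp_all add: quat_eq_iff algebra_simps)

end

instantiation quat :: real_algebra_1
begin

definition one_quat :: quat where "1 = Quat 1 0 0 0"

definition times_quat :: "quat \<Rightarrow> quat \<Rightarrow> quat" where
  "p * q = Quat
     (qRe p * qRe q - qIm1 p * qIm1 q - qIm2 p * qIm2 q - qIm3 p * qIm3 q)
     (qRe p * qIm1 q + qIm1 p * qRe q + qIm2 p * qIm3 q - qIm3 p * qIm2 q)
     (qRe p * qIm2 q - qIm1 p * qIm3 q + qIm2 p * qRe q + qIm3 p * qIm1 q)
     (qRe p * qIm3 q + qIm1 p * qIm2 q - qIm2 p * qIm1 q + qIm3 p * qRe q)"

lemma quat_mult_simps [simp]: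
  "qRe 1 = 1" "qIm1 1 = 0" "qIm2 1 = 0" "qIm3 1 = 0"
  "qRe (p * q) = qRe p * qRe q - qIm1 p * qIm1 q - qIm2 p * qIm2 q - qIm3 p * qIm3 q"
  "qIm1 (p * q) = qRe p * qIm1 q + qIm1 p * qRe q + qIm2 p * qIm3 q - qIm3 p * qIm2 q"
  "qIm2 (p * q) = qRe p * qIm2 q - qIm1 p * qIm3 q + qIm2 p * qRe q + qIm3 p * qIm1 q"
  "qIm3 (p * q) = qRe p * qIm3 q + qIm1 p * qIm2 q - qIm2 p * qIm1 q + qIm3 p * qRe q"
  by (simp_all add: one_quat_def times_quat_def)

instance
  by standard (simp_all add: quat_eq_iff algebra_simps)

end

instantiation quat :: real_normed_algebra_1
begin

definition norm_quat :: "quat \<Rightarrow> real" where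
  "norm q = sqrt ((qRe q)\<^sup>2 + (qIm1 q)\<^sup>2 + (qIm2 q)\<^sup>2 + (qIm3 q)\<^sup>2)"

definition dist_quat :: "quat \<Rightarrow> quat \<Rightarrow> real" where "dist p q = norm (p - q)" for p q :: quat

definition sgn_quat :: "quat \<Rightarrow> quat" where "sgn q = q /\<^sub>R norm q" for q :: quat

definition uniformity_quat :: "(quat \<times> quat) filter" where
  "(uniformity :: (quat \<times> quat) filter) = (INF e\<in>{0<..}. principal {(p, q). dist p q < e})"

definition open_quat :: "quat set \<Rightarrow> bool" where
  "open (U :: quat set) \<longleftrightarrow> (\<forall>x\<in>U. \<forall>\<^sub>F (x', y) in uniformity. x' = x \<longrightarrow> y \<in> U)"

lemma norm_quat_conv_Pair: "norm q = norm ((qRe q, qIm1 q), (qIm2 q, qIm3 q))"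
  by (simp add: norm_quat_def norm_Pair add.assoc)

lemma quat_norm_mult: "norm (p * q) = norm p * norm (q :: quat)"
  unfolding norm_quat_def real_sqrt_mult [symmetric]
  by (simp add: power2_eq_square algebra_simps)

instance
proof
  fix p q :: quat and c :: real
  show "norm p = 0 \<longleftrightarrow> p = 0"
    unfolding norm_quat_conv_Pair by (simp add: quat_eq_iff zero_prod_def)
  show "norm (p + q) \<le> norm p + norm q"
    using norm_triangle_ineq [of "((qRe p, qIm1 p), (qIm2 p, qIm3 p))"
                                 "((qRe q, qIm1 q), (qIm2 q, qIm3 q))"]
    by (simp add: norm_quat_conv_Pair)
  show "norm (c *\<^sub>R p) = \<bar>c\<bar> * norm p"
    using norm_scaleR [of c "((qRe p, qIm1 p), (qIm2 p, qIm3 p))"]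
    by (simp add: norm_quat_conv_Pair)
  show "norm (p * q) \<le> norm p * norm q"
    by (simp add: quat_norm_mult)
  show "norm (1 :: quat) = 1"
    by (simp add: norm_quat_def)
qed (simp_all add: dist_quat_def sgn_quat_def uniformity_quat_def open_quat_def)

end

definition quat_i :: quat where "quat_i = Quat 0 1 0 0"
definition quat_j :: quat where "quat_j = Quat 0 0 1 0"
definition quat_k :: quat where "quat_k = Quat 0 0 0 1"

definition quat_cnj :: "quat \<Rightarrow> quat" where
  "quat_cnj q = Quat (qRe q) (- qIm1 q) (- qIm2 q) (- qIm3 q)"

instantiation quat :: real_normed_div_algebra
begin

definition inverse_quat :: "quat \<Rightarrow> quat" where "inverse q = quat_cnj q /\<^sub>R (norm q)\<^sup>2"

definition divide_quat :: "quat \<Rightarrow> quat \<Rightarrow> quat" where "p div q = p * inverse q" for p q :: quat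

instance
proof
  fix p q :: quat
  have sq: "(norm p)\<^sup>2 = (qRe p)\<^sup>2 + (qIm1 p)\<^sup>2 + (qIm2 p)\<^sup>2 + (qIm3 p)\<^sup>2"
    by (simp add: norm_quat_def)
  have comm: "p * quat_cnj p = (norm p)\<^sup>2 *\<^sub>R 1" "quat_cnj p * p = (norm p)\<^sup>2 *\<^sub>R 1"
    unfolding sq by (simp_all add: quat_eq_iff quat_cnj_def power2_eq_square)
  show "inverse p * p = 1" "p * inverse p = 1" if "p \<noteq> 0"
    using that by (simp_all add: inverse_quat_def comm)
  show "inverse (0 :: quat) = 0"
    by (simp add: inverse_quat_def)
qed (simp_all add: divide_quat_def quat_norm_mult)

end


section \<open>Slice regular functions\<close>

definition imag_units :: "quat set" where
  "imag_units = {q. q\<^sup>2 = -1}"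

definition slice_plane :: "quat \<Rightarrow> quat set" where
  "slice_plane I = span {1, I}"

definition quat_sphere :: "real \<Rightarrow> real \<Rightarrow> quat set" where
  "quat_sphere \<alpha> \<beta> = {of_real \<alpha> + J * of_real \<beta> | J. J \<in> imag_units}"

definition symmetric_slice_domain :: "quat set \<Rightarrow> bool" where
  "symmetric_slice_domain \<Omega> \<longleftrightarrow>
     open \<Omega> \<and> connected \<Omega> \<and> \<Omega> \<inter> \<real> \<noteq> {} \<and>
     (\<forall>\<alpha> \<beta>. \<forall>I\<in>imag_units. of_real \<alpha> + I * of_real \<beta> \<in> \<Omega> \<longrightarrow> quat_sphere \<alpha> \<beta> \<subseteq> \<Omega>)"

text \<open>
  Functions on \<open>\<Omega>\<close> are modelled as total functions; only their values on \<open>\<Omega>\<close> matter, and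
  equality of functions always means equality on \<open>\<Omega>\<close>. Holomorphy of the restriction to a slice
  is real differentiability in \<open>(\<alpha>, \<beta>)\<close> together with the Cauchy-Riemann equation;
  \<open>D (1, 0)\<close> and \<open>D (0, 1)\<close> are the partial derivatives with respect to \<open>\<alpha>\<close> and \<open>\<beta>\<close>.
\<close>

definition slice_regular :: "quat set \<Rightarrow> (quat \<Rightarrow> quat) set" where
  "slice_regular \<Omega> = {f. \<forall>J\<in>imag_units. \<forall>\<alpha> \<beta>. of_real \<alpha> + J * of_real \<beta> \<in> \<Omega> \<longrightarrow>
     (\<exists>D. ((\<lambda>(a, b). f (of_real a + J * of_real b)) has_derivative D) (at (\<alpha>, \<beta>)) \<and>
          (1/2) *\<^sub>R (D (1, 0) + J * D (0, 1)) = 0)}"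

definition slice_preserving :: "quat set \<Rightarrow> (quat \<Rightarrow> quat) set" where
  "slice_preserving \<Omega> =
     {f \<in> slice_regular \<Omega>. \<forall>I\<in>imag_units. f ` (\<Omega> \<inter> slice_plane I) \<subseteq> slice_plane I}"


section \<open>The star product\<close>

definition is_slice_decomposition ::
  "quat set \<Rightarrow> (quat \<Rightarrow> quat) \<Rightarrow>
   (quat \<Rightarrow> quat) \<times> (quat \<Rightarrow> quat) \<times> (quat \<Rightarrow> quat) \<times> (quat \<Rightarrow> quat) \<Rightarrow> bool" where
  "is_slice_decomposition \<Omega> f = (\<lambda>(f0, f1, f2, f3).
     {f0, f1, f2, f3} \<subseteq> slice_preserving \<Omega> \<and>
     (\<forall>q\<in>\<Omega>. f q = f0 q + f1 q * quat_i + f2 q * quat_j + f3 q * quat_k))"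

text \<open>
  On a symmetric slice domain every slice regular function has a decomposition, and its components
  are uniquely determined on \<open>\<Omega>\<close> (they are arbitrary outside).
\<close>

definition slice_decomposition ::
  "quat set \<Rightarrow> (quat \<Rightarrow> quat) \<Rightarrow>
   (quat \<Rightarrow> quat) \<times> (quat \<Rightarrow> quat) \<times> (quat \<Rightarrow> quat) \<times> (quat \<Rightarrow> quat)" where
  "slice_decomposition \<Omega> f = (SOME F. is_slice_decomposition \<Omega> f F)"

definition star :: "quat set \<Rightarrow> (quat \<Rightarrow> quat) \<Rightarrow> (quat \<Rightarrow> quat) \<Rightarrow> quat \<Rightarrow> quat" where
  "star \<Omega> f g = (\<lambda>q.
     case (slice_decomposition \<Omega> f, slice_decomposition \<Omega> g) of
       ((f0, f1, f2, f3), (g0, g1, g2, g3)) \<Rightarrow>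
         f0 q * g0 q - f1 q * g1 q - f2 q * g2 q - f3 q * g3 q
         + f0 q * (g1 q * quat_i + g2 q * quat_j + g3 q * quat_k)
         + g0 q * (f1 q * quat_i + f2 q * quat_j + f3 q * quat_k)
         + (f2 q * g3 q - f3 q * g2 q) * quat_i
         + (f3 q * g1 q - f1 q * g3 q) * quat_j
         + (f1 q * g2 q - f2 q * g1 q) * quat_k)"


section \<open>Multiplicities\<close>

text \<open>
  The leading power and the product with it are pointwise: for slice preserving left factors this
  is the star product.
\<close>

definition sphere_factorization ::
  "quat set \<Rightarrow> (quat \<Rightarrow> quat) \<Rightarrow> real \<Rightarrow> real \<Rightarrow> nat \<Rightarrow> quat list \<Rightarrow> (quat \<Rightarrow> quat) \<Rightarrow> bool" where
  "sphere_factorization \<Omega> f \<alpha> \<beta> \<mu> ps g \<longleftrightarrow>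
     \<beta> \<noteq> 0 \<and> quat_sphere \<alpha> \<beta> \<subseteq> \<Omega> \<and>
     set ps \<subseteq> quat_sphere \<alpha> \<beta> \<and>
     (\<forall>\<nu>. Suc \<nu> < length ps \<longrightarrow> ps ! \<nu> \<noteq> quat_cnj (ps ! Suc \<nu>)) \<and>
     g \<in> slice_regular \<Omega> \<and> (\<forall>q\<in>quat_sphere \<alpha> \<beta>. g q \<noteq> 0) \<and>
     (\<forall>q\<in>\<Omega>. f q = ((q - of_real \<alpha>)\<^sup>2 + of_real (\<beta>\<^sup>2)) ^ \<mu> *
                     foldr (\<lambda>p. star \<Omega> (\<lambda>q. q - p)) ps g q)"

definition spherical_zero :: "quat set \<Rightarrow> (quat \<Rightarrow> quat) \<Rightarrow> quat set \<Rightarrow> bool" where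
  "spherical_zero \<Omega> f S \<longleftrightarrow>
     (\<exists>\<alpha> \<beta> \<mu> ps g. S = quat_sphere \<alpha> \<beta> \<and> sphere_factorization \<Omega> f \<alpha> \<beta> \<mu> ps g \<and> \<mu> \<ge> 1)"

text \<open>
  Relational form: \<open>p\<close> has positive isolated multiplicity \<open>n\<close>. Points that are not the first
  factor of such a factorization have isolated multiplicity \<open>0\<close>.
\<close>

definition has_isolated_multiplicity ::
  "quat set \<Rightarrow> (quat \<Rightarrow> quat) \<Rightarrow> quat \<Rightarrow> nat \<Rightarrow> bool" where
  "has_isolated_multiplicity \<Omega> f p n \<longleftrightarrow>
     n > 0 \<and> (\<exists>\<alpha> \<beta> \<mu> ps g. sphere_factorization \<Omega> f \<alpha> \<beta> \<mu> ps g \<and> length ps = n \<and> hd ps = p)"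

definition no_nonreal_isolated_zeros :: "quat set \<Rightarrow> (quat \<Rightarrow> quat) \<Rightarrow> bool" where
  "no_nonreal_isolated_zeros \<Omega> f \<longleftrightarrow> (\<forall>p \<in> \<Omega> - \<real>. \<nexists>n. has_isolated_multiplicity \<Omega> f p n)"

definition real_multiplicity :: "quat set \<Rightarrow> (quat \<Rightarrow> quat) \<Rightarrow> real \<Rightarrow> nat" where
  "real_multiplicity \<Omega> f x =
     (if of_real x \<in> \<Omega>
      then THE m. \<exists>h\<in>slice_regular \<Omega>. h (of_real x) \<noteq> 0 \<and>
                    (\<forall>q\<in>\<Omega>. f q = (q - of_real x) ^ m * h q)
      else 0)"

end

theory Submission
  imports Defs "HOL-Complex_Analysis.Complex_Analysis"
begin

text \<open>
  Write \<open>f\<close> through four stem functions \<open>F\<^sub>0, ..., F\<^sub>3\<close>, holomorphic on the planar slice \<open>D\<close> of the domain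
  and commuting with complex conjugation; the star product becomes the product of complexified
  quaternions, and \<open>N = F\<^sub>0\<^sup>2 + F\<^sub>1\<^sup>2 + F\<^sub>2\<^sup>2 + F\<^sub>3\<^sup>2\<close> is multiplicative. Let \<open>k z\<close> be the least order of the \<open>F\<^sub>l\<close> at
  \<open>z\<close>. Divide all \<open>F\<^sub>l\<close> by the \<open>k z\<close>-th power of the real polynomial with roots \<open>z\<close> and its conjugate.
  The norm of the quotient does not vanish at \<open>z\<close>: at a real \<open>z\<close> it is a sum of real squares, and at
  a nonreal \<open>z\<close> a zero would split off a linear star factor, and repeating this yields an isolated
  zero of \<open>f\<close>. Weierstrass products on \<open>D\<close>, made symmetric by means of holomorphic square roots,
  realise the orders \<open>k\<close> separately on the nonzero real points (\<open>R\<close>) and on the nonreal points (\<open>T\<close>).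
  The quotients \<open>F\<^sub>l / (z\<^sup>m R T)\<close> are the stem functions of \<open>h\<close>, and \<open>h\<close> has no zeros because its norm
  has none.
\<close>

text \<open>The obstacle is that complexified quaternions have zero divisors. At a nonreal z,
  \<open>N z = 0\<close> only says that f vanishes at some point of the sphere of z, whereas a
  spherical zero requires all four stem functions to vanish at z. The hypothesis on isolated zeros
  closes this gap, and its effect is that N has order exactly \<open>2 * k z\<close> at every z of
  D. This makes k half the order of a single symmetric holomorphic function that is not identically
  zero, so that k is locally finite and invariant under conjugation, as a symmetric Weierstrass
  product requires. The same equality shows that N loses all its zeros when the \<open>F l\<close>
  are divided by a function with orders k. Simple connectedness of the slice supplies the square
  roots: a Weierstrass product with symmetric zeros agrees with its reflection only up to a factor
  without zeros, and this factor has to be shared equally between the two.\<close>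

subsection \<open>Weierstrass products on open sets\<close>

text \<open>The index set is a parameter, so that finitely many zeros are covered and the factors
  vanishing at a given point can be removed from the product. The factor with index n has genus n,
  hence the eventual bound 1/2 on \<open>u n\<close> already forces convergence.\<close>

definition factor_product :: "(nat \<Rightarrow> complex \<Rightarrow> complex) \<Rightarrow> nat set \<Rightarrow> complex \<Rightarrow> complex" where
  "factor_product u I z = (\<Prod>n. if n \<in> I then weierstrass_factor n (u n z) else 1)"

context
  fixes D :: "complex set" and u :: "nat \<Rightarrow> complex \<Rightarrow> complex" and I :: "nat set"
  assumes openD: "open D"
    and hol_u: "\<And>n. n \<in> I \<Longrightarrow> u n holomorphic_on D"
    and small_u: "\<And>L. compact L \<Longrightarrow> L \<subseteq> D \<Longrightarrow>
      \<forall>\<^sub>F n in sequentially. \<forall>z\<in>L. n \<in> I \<longrightarrow> norm (u n z) \<le> 1/2"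
begin

private abbreviation fac :: "nat set \<Rightarrow> nat \<Rightarrow> complex \<Rightarrow> complex" where
  "fac J n z \<equiv> (if n \<in> J then weierstrass_factor n (u n z) else 1)"

text \<open>On the disc of radius 1/2 a Weierstrass factor of genus n differs from 1 by at most
  three times the power n + 1 of the modulus. The doubled norm is the form in which the M-test meets
  the series of the moduli.\<close>

lemma factor_bound_ev:
  assumes "compact L" "L \<subseteq> D" "J \<subseteq> I"
  shows "\<forall>\<^sub>F n in sequentially. \<forall>z\<in>L. norm (norm (fac J n z - 1)) \<le> 3 * (1/2) ^ Suc n"
  using small_u[OF assms(1,2)]
proof eventually_elim
  case (elim n)
  show ?case
  proof (intro ballI)
    fix z assume z: "z \<in> L"
    show "norm (norm (fac J n z - 1)) \<le> 3 * (1/2) ^ Suc n"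
    proof (cases "n \<in> J")
      case True
      then have *: "norm (u n z) \<le> 1/2" using elim z assms(3) by auto
      have "norm (weierstrass_factor n (u n z) - 1) \<le> 3 * norm (u n z) ^ Suc n"
        by (rule weierstrass_factor_bound[OF *])
      also have "\<dots> \<le> 3 * (1/2) ^ Suc n"
        by (intro mult_left_mono power_mono *) auto
      finally show ?thesis using True by simp
    qed auto
  qed
qed

lemma factor_bound_summable: "summable (\<lambda>n. 3 * (1/2 :: real) ^ Suc n)"
  by (intro summable_mult) (simp add: summable_Suc_iff summable_geometric)

lemma factor_convergent:
  assumes "z \<in> D" "J \<subseteq> I"
  shows "convergent_prod (\<lambda>n. fac J n z)"
proof -
  have "abs_convergent_prod (\<lambda>n. fac J n z)"
    unfolding abs_convergent_prod_conv_summable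
    using factor_bound_ev[of "{z}" J] assms
    by (intro summable_comparison_test_ev[OF _ factor_bound_summable]) auto
  then show ?thesis by (rule abs_convergent_prod_imp_convergent_prod)
qed

lemma factor_product_uniform_limit:
  assumes "compact L" "L \<subseteq> D" "J \<subseteq> I"
  shows "uniform_limit L (\<lambda>N z. \<Prod>n<N. fac J n z) (factor_product u J) sequentially"
proof -
  have "uniformly_convergent_on L (\<lambda>N z. \<Prod>n<N. fac J n z)"
  proof (rule uniformly_convergent_on_prod')
    show "continuous_on L (fac J n)" for n
    proof (cases "n \<in> J")
      case True
      then have "continuous_on L (u n)"
        using hol_u[of n] assms by (meson holomorphic_on_imp_continuous_on continuous_on_subset subsetD)
      then show ?thesis using True by (auto intro!: continuous_intros)
    qed auto
    show "uniformly_convergent_on L (\<lambda>N z. \<Sum>n<N. norm (fac J n z - 1))"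
      by (rule Weierstrass_m_test'_ev[OF factor_bound_ev[OF assms] factor_bound_summable])
  qed (rule assms)
  then obtain g where g: "uniform_limit L (\<lambda>N z. \<Prod>n<N. fac J n z) g sequentially"
    by (auto simp: uniformly_convergent_on_def)
  also have "?this \<longleftrightarrow> ?thesis"
  proof (intro uniform_limit_cong)
    fix z assume z: "z \<in> L"
    \<comment> \<open>The index is shifted by one because \<open>convergent_prod_LIMSEQ\<close>
      speaks of products up to and including N.\<close>
    have "(\<lambda>N. \<Prod>n<Suc N. fac J n z) \<longlonglongrightarrow> g z"
      using tendsto_uniform_limitI[OF g z] by (subst filterlim_sequentially_Suc)
    moreover have "(\<lambda>N. \<Prod>n<Suc N. fac J n z) \<longlonglongrightarrow> factor_product u J z"
      using convergent_prod_LIMSEQ[OF factor_convergent[of z J]] z assms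
      unfolding factor_product_def lessThan_Suc_atMost by auto
    ultimately show "g z = factor_product u J z"
      by (rule tendsto_unique[OF sequentially_bot])
  qed auto
  finally show ?thesis .
qed

lemma factor_product_holomorphic:
  assumes "J \<subseteq> I"
  shows "factor_product u J holomorphic_on D"
proof (rule holomorphic_uniform_sequence[OF openD])
  show "(\<lambda>z. \<Prod>n<N. fac J n z) holomorphic_on D" for N
  proof (rule holomorphic_on_prod)
    fix n
    show "fac J n holomorphic_on D"
      using hol_u[of n] assms by (cases "n \<in> J") (auto intro!: holomorphic_intros)
  qed
  fix z assume "z \<in> D"
  then obtain d where "d > 0" "cball z d \<subseteq> D"
    using openD open_contains_cball by blast
  then show "\<exists>d>0. cball z d \<subseteq> D \<and>
      uniform_limit (cball z d) (\<lambda>N z. \<Prod>n<N. fac J n z) (factor_product u J) sequentially"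
    using factor_product_uniform_limit[OF compact_cball _ assms] by blast
qed

lemma factor_product_nonzero:
  assumes "z \<in> D" "J \<subseteq> I" "\<And>n. n \<in> J \<Longrightarrow> u n z \<noteq> 1"
  shows "factor_product u J z \<noteq> 0"
  unfolding factor_product_def
  by (rule prodinf_nonzero[OF factor_convergent]) (use assms in auto)

lemma factor_product_split:
  assumes "z \<in> D" "finite A" "A \<subseteq> I"
  shows "factor_product u I z = (\<Prod>n\<in>A. weierstrass_factor n (u n z)) * factor_product u (I - A) z"
proof -
  have 1: "convergent_prod (\<lambda>n. fac A n z)" "convergent_prod (\<lambda>n. fac (I - A) n z)"
    by (rule factor_convergent; use assms in auto)+
  have "(\<Prod>n\<in>A. weierstrass_factor n (u n z)) = (\<Prod>n. fac A n z)"
    by (subst prodinf_finite[OF assms(2)]) auto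
  then have "(\<Prod>n\<in>A. weierstrass_factor n (u n z)) * factor_product u (I - A) z
      = (\<Prod>n. fac A n z * fac (I - A) n z)"
    unfolding factor_product_def using prodinf_mult[OF 1] by simp
  also have "\<dots> = factor_product u I z"
    unfolding factor_product_def using assms by (intro prodinf_cong) auto
  finally show ?thesis ..
qed

end

lemma countable_if_locally_finite:
  fixes D :: "'a::euclidean_space set"
  assumes "open D" and fin: "\<And>L. compact L \<Longrightarrow> L \<subseteq> D \<Longrightarrow> finite {z\<in>L. P z}"
  shows "countable {z\<in>D. P z}"
proof -
  obtain F :: "nat \<Rightarrow> 'a set" where F: "\<And>i. compact (F i)" "\<And>i. F i \<subseteq> D" "\<Union>(range F) = D"
    using open_Union_compact_subsets[OF assms(1)] by metis
  then have "finite {z \<in> F i. P z}" for i using fin by blast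
  moreover have "{z\<in>D. P z} = (\<Union>i. {z \<in> F i. P z})" using F by auto
  ultimately show ?thesis by (simp add: countable_finite)
qed

text \<open>
  After the Moebius change of variable \<open>w = 1 / (z - zs)\<close> the complement of \<open>D\<close> becomes a compact
  set \<open>K\<close>, and the factor belonging to a zero is written with its nearest point of \<open>K\<close>.
\<close>
lemma weierstrass_open_set:
  fixes D :: "complex set" and k :: "complex \<Rightarrow> nat"
  assumes openD: "open D"
    and fin: "\<And>L. compact L \<Longrightarrow> L \<subseteq> D \<Longrightarrow> finite {z\<in>L. k z \<noteq> 0}"
    and zs: "zs \<in> D" "k zs = 0"
  obtains W where "W holomorphic_on D"
    "\<And>z. z \<in> D \<Longrightarrow> \<exists>G. G holomorphic_on D \<and> G z \<noteq> 0 \<and> (\<forall>w\<in>D. W w = (w - z) ^ k z * G w)"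
proof -
  \<comment> \<open>One pair (z, i) with i < k z for each zero counted with multiplicity; an
    enumeration of P makes the sequence \<open>a\<close> take each such value z exactly k z
    times.\<close>
  define P where "P = Sigma {z\<in>D. k z \<noteq> 0} (\<lambda>z. {..<k z})"
  have "countable P"
    unfolding P_def using countable_if_locally_finite[OF openD fin] by (intro countable_SIGMA) auto
  define I where "I = to_nat_on P ` P"
  define a where "a = (\<lambda>n. fst (from_nat_into P n))"
  have a_en: "a (to_nat_on P p) = fst p" if "p \<in> P" for p
    unfolding a_def using that \<open>countable P\<close> by simp
  have inj: "inj_on (to_nat_on P) P" using \<open>countable P\<close> by (rule inj_on_to_nat_on)
  have a_in: "a n \<in> D" "k (a n) \<noteq> 0" if "n \<in> I" for n
    using that a_en unfolding I_def by (auto simp: P_def)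
  have a_zs: "a n \<noteq> zs" if "n \<in> I" for n using a_in(2)[OF that] zs by auto
  have fin_a: "finite {n\<in>I. a n \<in> L}" if "compact L" "L \<subseteq> D" for L
  proof (rule finite_subset)
    show "{n\<in>I. a n \<in> L} \<subseteq> to_nat_on P ` Sigma {z\<in>L. k z \<noteq> 0} (\<lambda>z. {..<k z})"
      using a_en unfolding I_def by (force simp: P_def)
    show "finite (to_nat_on P ` Sigma {z\<in>L. k z \<noteq> 0} (\<lambda>z. {..<k z}))"
      using fin[OF that] by auto
  qed
  have fibre: "finite {n\<in>I. a n = z}" "card {n\<in>I. a n = z} = k z" if "z \<in> D" for z
  proof -
    have eq: "{n\<in>I. a n = z} = to_nat_on P ` ({z} \<times> {..<k z})"
      using a_en that unfolding I_def by (force simp: P_def)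
    have "inj_on (to_nat_on P) ({z} \<times> {..<k z})"
      by (rule inj_on_subset[OF inj]) (use that in \<open>auto simp: P_def\<close>)
    then show "finite {n\<in>I. a n = z}" "card {n\<in>I. a n = z} = k z"
      unfolding eq by (auto simp: card_image)
  qed

  define \<alpha> where "\<alpha> = (\<lambda>n. 1 / (a n - zs))"
  \<comment> \<open>The complement of the image of D under z -> 1 / (z - zs), where zs goes to
    infinity. The condition is stated as a product, so that w = 0 and z = zs need no special
    treatment.\<close>
  define K where "K = {w. \<forall>z\<in>D. w * (z - zs) \<noteq> 1}"
  have K0: "0 \<in> K" by (simp add: K_def)
  have notK: "w \<noteq> 0" "zs + 1 / w \<in> D" if "w \<notin> K" for w
  proof -
    obtain z where z: "z \<in> D" "w * (z - zs) = 1" using \<open>w \<notin> K\<close> by (auto simp: K_def)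
    then show "w \<noteq> 0" by auto
    then have "zs + 1 / w = z" using z by (simp add: field_simps)
    with z show "zs + 1 / w \<in> D" by simp
  qed
  have "- K = (- {0}) \<inter> (\<lambda>w. zs + 1 / w) -` D"
  proof (intro set_eqI iffI)
    fix w assume "w \<in> (- {0}) \<inter> (\<lambda>w. zs + 1 / w) -` D"
    then have "w \<noteq> 0" "zs + 1 / w \<in> D" "w * ((zs + 1 / w) - zs) = 1" by auto
    then show "w \<in> - K" unfolding K_def by blast
  qed (use notK in auto)
  moreover have "open ((- {0}) \<inter> (\<lambda>w. zs + 1 / w) -` D)"
    by (intro continuous_open_preimage openD) (auto intro!: continuous_intros)
  ultimately have closedK: "closed K" by (simp only: closed_def)
  have "\<exists>b\<in>K. infdist (\<alpha> n) K = dist (\<alpha> n) b" for n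
    using infdist_attains_inf[OF closedK, of "\<alpha> n"] K0 by blast
  then obtain b where b: "b n \<in> K" and infd: "infdist (\<alpha> n) K = dist (\<alpha> n) (b n)" for n
    by metis
  have dn: "1 - b n * (z - zs) \<noteq> 0" if "z \<in> D" for n z
    using b[of n] that by (auto simp: K_def)

  \<comment> \<open>Only finitely many zeros lie in a closed disc of radius r around zs, and all
    others have \<open>\<alpha> n\<close> of modulus at most 1 / r.\<close>
  obtain M where M: "M > 0" "\<And>n. n \<in> I \<Longrightarrow> norm (\<alpha> n) \<le> M"
  proof -
    obtain r where r: "r > 0" "cball zs r \<subseteq> D" using openD zs open_contains_cball by blast
    have "\<alpha> ` I \<subseteq> \<alpha> ` {n\<in>I. a n \<in> cball zs r} \<union> cball 0 (1 / r)"
    proof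
      fix w assume "w \<in> \<alpha> ` I"
      then obtain n where n: "n \<in> I" "w = \<alpha> n" by auto
      show "w \<in> \<alpha> ` {n\<in>I. a n \<in> cball zs r} \<union> cball 0 (1 / r)"
      proof (cases "a n \<in> cball zs r")
        case False
        then have "norm (a n - zs) > r" by (simp add: dist_norm norm_minus_commute)
        then have "norm w \<le> 1 / r" using n r by (simp add: \<alpha>_def norm_divide frac_le)
        then show ?thesis by simp
      qed (use n in auto)
    qed
    moreover have "bounded (\<alpha> ` {n\<in>I. a n \<in> cball zs r} \<union> cball 0 (1 / r))"
      using fin_a[OF compact_cball r(2)] by (auto intro: finite_imp_bounded)
    ultimately have "bounded (\<alpha> ` I)" by (rule bounded_subset[rotated])
    then show ?thesis using that by (auto simp: bounded_pos)
  qed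

  \<comment> \<open>The points of modulus at most M and at distance at least e from K form a compact
    set off K. Its preimage under the change of variable is compact in D and so contains only
    finitely many zeros. Hence \<open>\<alpha> n - b n\<close> tends to 0 along an infinite
    I.\<close>
  have near: "finite {n\<in>I. dist (\<alpha> n) (b n) \<ge> e}" if "e > 0" for e
  proof -
    define C where "C = {w\<in>cball 0 M. e \<le> infdist w K}"
    have "C = cball 0 M \<inter> {w. e \<le> infdist w K}" by (auto simp: C_def)
    then have "compact C"
      by (auto intro!: compact_Int_closed closed_Collect_le continuous_intros)
    have CK: "w \<notin> K" if "w \<in> C" for w
      using that \<open>e > 0\<close> by (auto simp: C_def)
    have "compact ((\<lambda>w. zs + 1 / w) ` C)"
      using notK(1) CK \<open>compact C\<close>
      by (intro compact_continuous_image) (auto intro!: continuous_intros)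
    moreover have "(\<lambda>w. zs + 1 / w) ` C \<subseteq> D" using notK(2) CK by auto
    ultimately have "finite {n\<in>I. a n \<in> (\<lambda>w. zs + 1 / w) ` C}" by (rule fin_a)
    moreover have "{n\<in>I. dist (\<alpha> n) (b n) \<ge> e} \<subseteq> {n\<in>I. a n \<in> (\<lambda>w. zs + 1 / w) ` C}"
    proof safe
      fix n assume n: "n \<in> I" "e \<le> dist (\<alpha> n) (b n)"
      then have "\<alpha> n \<in> C" using M infd by (simp add: C_def)
      moreover have "a n = zs + 1 / \<alpha> n" using a_zs[OF n(1)] by (simp add: \<alpha>_def)
      ultimately show "a n \<in> (\<lambda>w. zs + 1 / w) ` C" by blast
    qed
    ultimately show ?thesis by (rule finite_subset[rotated])
  qed

  \<comment> \<open>In the variable w = 1 / (z - zs) this is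
    \<open>(\<alpha> n - b n) / (w - b n)\<close>: it equals 1 only at w =
    \<open>\<alpha> n\<close>, that is at z = \<open>a n\<close>, and its pole \<open>b n\<close>
    lies in K. Expressed in z it is also holomorphic at zs, with value 0.\<close>
  define u where "u = (\<lambda>n z. (\<alpha> n - b n) * (z - zs) / (1 - b n * (z - zs)))"
  have hol_u: "u n holomorphic_on D" for n
    unfolding u_def using dn by (auto intro!: holomorphic_intros)
  have small: "\<forall>\<^sub>F n in sequentially. \<forall>z\<in>L. n \<in> I \<longrightarrow> norm (u n z) \<le> 1/2"
    if L: "compact L" "L \<subseteq> D" for L
  proof -
    \<comment> \<open>Since 0 lies in K, the nearest point \<open>b n\<close> is at most M away from
      \<open>\<alpha> n\<close>, which gives the radius 2 * M.\<close>
    define B where "B = K \<inter> cball 0 (2 * M)"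
    have compB: "compact (B \<times> L)"
      unfolding B_def using closedK L by (intro compact_Times closed_Int_compact) auto
    obtain c where c: "c > 0" "\<And>p. p \<in> B \<times> L \<Longrightarrow> c \<le> norm (1 - fst p * (snd p - zs))"
    proof (cases "B \<times> L = {}")
      case False
      have "continuous_on (B \<times> L) (\<lambda>p. norm (1 - fst p * (snd p - zs)))"
        by (auto intro!: continuous_intros)
      from continuous_attains_inf[OF compB False this] obtain p where
        p: "p \<in> B \<times> L" "\<forall>q\<in>B \<times> L. norm (1 - fst p * (snd p - zs)) \<le> norm (1 - fst q * (snd q - zs))"
        by blast
      have "fst p * (snd p - zs) \<noteq> 1" using p(1) L by (auto simp: B_def K_def)
      then show ?thesis using that[of "norm (1 - fst p * (snd p - zs))"] p by auto
    qed (use that[of 1] in auto)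
    obtain R where R: "R > 0" "\<And>z. z \<in> L \<Longrightarrow> norm (z - zs) \<le> R"
    proof -
      have "bounded ((\<lambda>z. z - zs) ` L)"
        by (intro compact_imp_bounded compact_continuous_image L) (auto intro!: continuous_intros)
      then show ?thesis using that by (auto simp: bounded_pos)
    qed
    \<comment> \<open>Chosen so that the resulting bound \<open>e * R / c\<close> on
      \<open>u n z\<close> is 1/2.\<close>
    define e where "e = c / (2 * R)"
    have "e > 0" using c R by (simp add: e_def)
    from near[OF this] obtain N where N: "\<And>n. n \<in> I \<Longrightarrow> e \<le> dist (\<alpha> n) (b n) \<Longrightarrow> n < N"
      unfolding finite_nat_set_iff_bounded by blast
    have "norm (u n z) \<le> 1/2" if n: "n \<ge> N" "n \<in> I" and z: "z \<in> L" for n z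
    proof -
      have d: "norm (\<alpha> n - b n) \<le> e" using N[OF n(2)] n(1) by (force simp: dist_norm)
      have "dist (\<alpha> n) (b n) \<le> M" using infdist_le[OF K0, of "\<alpha> n"] infd[of n] M(2)[OF n(2)] by simp
      then have "norm (b n) \<le> 2 * M"
        using M(2)[OF n(2)] norm_triangle_ineq4[of "\<alpha> n" "\<alpha> n - b n"] by (simp add: dist_norm)
      then have "(b n, z) \<in> B \<times> L" using b z by (simp add: B_def)
      from c(2)[OF this] have "c \<le> norm (1 - b n * (z - zs))" by simp
      then have "norm (u n z) \<le> (e * R) / c"
        unfolding u_def norm_divide norm_mult
        by (intro frac_le mult_mono d R z c) (use \<open>e > 0\<close> R in auto)
      also have "\<dots> = 1/2" using c R by (simp add: e_def)
      finally show ?thesis .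
    qed
    then show ?thesis unfolding eventually_sequentially by blast
  qed
  have u1: "z = a n" if "u n z = 1" "z \<in> D" "n \<in> I" for n z
  proof -
    have "\<alpha> n * (z - zs) = 1" using that dn[OF that(2), of n] by (simp add: u_def field_simps)
    then show ?thesis using a_zs[OF that(3)] by (simp add: \<alpha>_def field_simps)
  qed

  note fp = factor_product_holomorphic[of D I u] factor_product_nonzero[of D I u]
    factor_product_split[of D I u]
  show ?thesis
  proof (rule that)
    show "factor_product u I holomorphic_on D"
      by (rule fp(1)[OF openD hol_u small]) auto
    fix z assume z: "z \<in> D"
    define A where "A = {n\<in>I. a n = z}"
    \<comment> \<open>What remains of the n-th Weierstrass factor once w - z is divided out, for an
      index with \<open>a n = z\<close>.\<close>
    define g where "g = (\<lambda>n w. - \<alpha> n / (1 - b n * (w - zs)) * exp (\<Sum>k=1..n. u n w ^ k / of_nat k))"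
    have "(\<lambda>w. (\<Prod>n\<in>A. g n w) * factor_product u (I - A) w) holomorphic_on D"
      unfolding g_def using dn
      by (intro holomorphic_intros fp(1)[OF openD hol_u small] hol_u) auto
    moreover have "(\<Prod>n\<in>A. g n z) * factor_product u (I - A) z \<noteq> 0"
    proof -
      have "factor_product u (I - A) z \<noteq> 0"
        using u1[OF _ z] by (intro fp(2)[OF openD hol_u small z]) (auto simp: A_def)
      moreover have "(\<Prod>n\<in>A. g n z) \<noteq> 0"
        using fibre(1)[OF z] dn[OF z] a_zs by (auto simp: g_def \<alpha>_def A_def)
      ultimately show ?thesis by simp
    qed
    moreover have "factor_product u I w = (w - z) ^ k z * ((\<Prod>n\<in>A. g n w) * factor_product u (I - A) w)"
      if w: "w \<in> D" for w
    proof -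
      have "weierstrass_factor n (u n w) = (w - z) * g n w" if "n \<in> A" for n
      proof -
        have "1 - u n w = (1 - \<alpha> n * (w - zs)) / (1 - b n * (w - zs))"
          using dn[OF w, of n] by (simp add: u_def field_simps)
        also have "1 - \<alpha> n * (w - zs) = (w - z) * (- \<alpha> n)"
          using a_zs[of n] that by (auto simp: \<alpha>_def A_def field_simps)
        finally show ?thesis by (simp add: weierstrass_factor_def g_def)
      qed
      then have "(\<Prod>n\<in>A. weierstrass_factor n (u n w)) = (w - z) ^ k z * (\<Prod>n\<in>A. g n w)"
        using fibre(2)[OF z] by (simp add: prod.distrib A_def)
      then show ?thesis
        using fp(3)[OF openD hol_u small w fibre(1)[OF z]] by (simp add: A_def mult.assoc)
    qed
    ultimately show "\<exists>G. G holomorphic_on D \<and> G z \<noteq> 0 \<and>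
        (\<forall>w\<in>D. factor_product u I w = (w - z) ^ k z * G w)"
      by blast
  qed
qed

subsection \<open>Orders of zeros\<close>

text \<open>A and B agree on the nonempty open set where M does not vanish, and the identity theorem
  extends this to D.\<close>

lemma holomorphic_mult_left_cancel:
  assumes "open D" "connected D" "M holomorphic_on D" "A holomorphic_on D" "B holomorphic_on D"
    and "z0 \<in> D" "M z0 \<noteq> 0" and eq: "\<And>w. w \<in> D \<Longrightarrow> M w * A w = M w * B w"
    and "z \<in> D"
  shows "A z = B z"
proof (rule analytic_continuation_open[of "D \<inter> M -` (- {0})" D A B])
  show "open (D \<inter> M -` (- {0}))"
    using assms by (intro continuous_open_preimage) (auto intro: holomorphic_on_imp_continuous_on)
qed (use assms in auto)

text \<open>Away from z the power can be divided out; at z both values are limits of the same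
  function.\<close>

lemma power_mult_left_cancel:
  fixes G H :: "complex \<Rightarrow> complex"
  assumes "open D" "G holomorphic_on D" "H holomorphic_on D"
    and eq: "\<And>w. w \<in> D \<Longrightarrow> (w - z) ^ k * G w = (w - z) ^ k * H w"
    and "w \<in> D"
  shows "G w = H w"
proof (cases "w = z")
  case True
  have "isCont G z" "isCont H z"
    using assms True by (auto simp: continuous_on_eq_continuous_at dest!: holomorphic_on_imp_continuous_on)
  then have lim: "(G \<longlongrightarrow> G z) (at z)" "(H \<longlongrightarrow> H z) (at z)" by (auto simp: isCont_def)
  have "\<forall>\<^sub>F w in at z. w \<in> D - {z}"
    using eventually_at_in_open[OF assms(1), of z] assms(5) True by blast
  then have "\<forall>\<^sub>F w in at z. G w = H w" by eventually_elim (use eq in auto)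
  then have "(H \<longlongrightarrow> G z) (at z)" using lim(1) by (simp add: tendsto_cong)
  then show ?thesis using lim(2) True LIM_unique by blast
qed (use assms in auto)

lemma order_le:
  fixes G H :: "complex \<Rightarrow> complex"
  assumes "open D" "G holomorphic_on D" "H holomorphic_on D" "z \<in> D" "G z \<noteq> 0"
    and eq: "\<And>w. w \<in> D \<Longrightarrow> (w - z) ^ j * G w = (w - z) ^ k * H w"
  shows "k \<le> j"
proof (rule ccontr)
  assume "\<not> k \<le> j"
  then obtain i where i: "k = j + Suc i" using less_imp_Suc_add[of j k] by auto
  have "G z = (z - z) ^ Suc i * H z"
  proof (rule power_mult_left_cancel[OF assms(1,2) _ _ assms(4), where H = "\<lambda>w. (w - z) ^ Suc i * H w"])
    show "(\<lambda>w. (w - z) ^ Suc i * H w) holomorphic_on D"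
      by (intro holomorphic_intros assms)
    show "(w - z) ^ j * G w = (w - z) ^ j * ((w - z) ^ Suc i * H w)" if "w \<in> D" for w
      unfolding eq[OF that] i power_add by (simp only: mult.assoc)
  qed
  then show False using assms(5) by simp
qed

lemma order_unique:
  fixes G H :: "complex \<Rightarrow> complex"
  assumes "open D" "G holomorphic_on D" "H holomorphic_on D" "z \<in> D" "G z \<noteq> 0" "H z \<noteq> 0"
    and eq: "\<And>w. w \<in> D \<Longrightarrow> (w - z) ^ j * G w = (w - z) ^ k * H w"
  shows "j = k"
  using order_le[of D G H z j k] order_le[of D H G z k j] assms by force

lemma holomorphic_divide_zero:
  assumes "open D" "F holomorphic_on D" "F z0 = 0"
  obtains G where "G holomorphic_on D" "\<And>w. w \<in> D \<Longrightarrow> F w = (w - z0) * G w"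
proof -
  define G where "G = (\<lambda>w. if w = z0 then deriv F z0 else F w / (w - z0))"
  show ?thesis
    by (rule that[of G], rule pole_theorem_open_0[OF assms(2,1), of z0]) (use assms in \<open>auto simp: G_def\<close>)
qed

text \<open>Supplies the bound from which a largest exponent can later be chosen. Near z0 the
  function has a factorization with some exponent n and a cofactor without zeros, and
  \<open>order_le\<close> compares every other exponent with n.\<close>

lemma order_bound:
  assumes "open D" "connected D" "F holomorphic_on D" "z1 \<in> D" "F z1 \<noteq> 0" "z0 \<in> D"
  shows "\<exists>n. \<forall>j G. G holomorphic_on D \<longrightarrow> (\<forall>w\<in>D. F w = (w - z0) ^ j * G w) \<longrightarrow> j \<le> n"
proof -
  have "\<exists>n r g. r > 0 \<and> ball z0 r \<subseteq> D \<and> g holomorphic_on ball z0 r \<and>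
      (\<forall>w\<in>ball z0 r. F w = (w - z0) ^ n * g w \<and> g w \<noteq> 0)"
  proof (cases "F z0 = 0")
    case True
    have "\<not> F constant_on D" using True assms unfolding constant_on_def by metis
    from holomorphic_factor_zero_nonconstant[OF assms(3,1,2,6) True this] show ?thesis by metis
  next
    case False
    have "open (D \<inter> F -` (- {0}))"
      using assms by (intro continuous_open_preimage) (auto intro: holomorphic_on_imp_continuous_on)
    then obtain r where "r > 0" "ball z0 r \<subseteq> D \<inter> F -` (- {0})"
      using False assms(6) openE[of _ z0] by (metis ComplI IntI singletonD vimageI)
    then show ?thesis
      using holomorphic_on_subset[OF assms(3), of "ball z0 r"]
      by (intro exI[of _ 0] exI[of _ r] exI[of _ F]) auto
  qed
  then obtain n r g where nrg: "r > 0" "ball z0 r \<subseteq> D" "g holomorphic_on ball z0 r"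
    "\<And>w. w \<in> ball z0 r \<Longrightarrow> F w = (w - z0) ^ n * g w \<and> g w \<noteq> 0" by blast
  have "j \<le> n" if "G holomorphic_on D" "\<forall>w\<in>D. F w = (w - z0) ^ j * G w" for j G
    by (rule order_le[of "ball z0 r" g G z0 n j])
      (use nrg that holomorphic_on_subset[OF that(1) nrg(2)] in \<open>auto simp: subset_iff\<close>)
  then show ?thesis by blast
qed

text \<open>The cofactor lives on all of D, so that it can be multiplied, cancelled and reflected
  without passing to neighbourhoods. Where k is 0 the condition says that W does not vanish.\<close>

definition has_orders :: "complex set \<Rightarrow> (complex \<Rightarrow> complex) \<Rightarrow> (complex \<Rightarrow> nat) \<Rightarrow> bool" where
  "has_orders D W k \<longleftrightarrow>
     (\<forall>z\<in>D. \<exists>G. G holomorphic_on D \<and> G z \<noteq> 0 \<and> (\<forall>w\<in>D. W w = (w - z) ^ k z * G w))"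

lemma has_ordersE:
  assumes "has_orders D W k" "z \<in> D"
  obtains G where "G holomorphic_on D" "G z \<noteq> 0" "\<And>w. w \<in> D \<Longrightarrow> W w = (w - z) ^ k z * G w"
  using assms unfolding has_orders_def by blast

lemma has_orders_holomorphic:
  assumes "has_orders D W k"
  shows "W holomorphic_on D"
proof (cases "D = {}")
  case False
  then obtain z G where "G holomorphic_on D" "\<And>w. w \<in> D \<Longrightarrow> W w = (w - z) ^ k z * G w"
    using has_ordersE[OF assms] by (metis ex_in_conv)
  moreover from this(1) have "(\<lambda>w. (w - z) ^ k z * G w) holomorphic_on D"
    by (intro holomorphic_intros)
  ultimately show ?thesis by (simp cong: holomorphic_cong)
qed (simp add: holomorphic_on_def)

lemma has_orders_zero_iff: "has_orders D W k \<Longrightarrow> z \<in> D \<Longrightarrow> W z = 0 \<longleftrightarrow> k z \<noteq> 0"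
  by (erule has_ordersE) auto

lemma has_orders_mult:
  assumes "has_orders D V j" "has_orders D W k"
  shows "has_orders D (\<lambda>z. V z * W z) (\<lambda>z. j z + k z)"
  unfolding has_orders_def
proof
  fix z assume z: "z \<in> D"
  obtain G where "G holomorphic_on D" "G z \<noteq> 0" "\<And>w. w \<in> D \<Longrightarrow> V w = (w - z) ^ j z * G w"
    using has_ordersE[OF assms(1) z] by blast
  moreover obtain H where "H holomorphic_on D" "H z \<noteq> 0" "\<And>w. w \<in> D \<Longrightarrow> W w = (w - z) ^ k z * H w"
    using has_ordersE[OF assms(2) z] by blast
  ultimately show "\<exists>G. G holomorphic_on D \<and> G z \<noteq> 0 \<and>
      (\<forall>w\<in>D. V w * W w = (w - z) ^ (j z + k z) * G w)"
    by (intro exI[of _ "\<lambda>w. G w * H w"]) (auto intro!: holomorphic_intros simp: power_add)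
qed

lemma has_orders_monomial: "has_orders D (\<lambda>z. z ^ m) (\<lambda>z. if z = 0 then m else 0)"
  unfolding has_orders_def
proof
  fix z assume "z \<in> D"
  show "\<exists>G. G holomorphic_on D \<and> G z \<noteq> 0 \<and> (\<forall>w\<in>D. w ^ m = (w - z) ^ (if z = 0 then m else 0) * G w)"
    by (cases "z = 0") (rule exI[of _ "\<lambda>_. 1"], simp, rule exI[of _ "\<lambda>w. w ^ m"],
        auto intro!: holomorphic_intros)
qed

text \<open>The value of H at z is obtained by cancelling the power of w - z in both functions and
  evaluating the cofactors at z. Near a fixed z this agrees with the quotient of the two cofactors
  belonging to z, because W has no other zero where the cofactor of W is nonzero.\<close>

lemma holomorphic_quotient:
  assumes "open D" "has_orders D W k"
    and F: "\<And>z. z \<in> D \<Longrightarrow> \<exists>G. G holomorphic_on D \<and> (\<forall>w\<in>D. F w = (w - z) ^ k z * G w)"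
  obtains H where "H holomorphic_on D" "\<And>w. w \<in> D \<Longrightarrow> F w = W w * H w"
proof -
  obtain G where G: "\<And>z. z \<in> D \<Longrightarrow> G z holomorphic_on D"
      "\<And>z w. z \<in> D \<Longrightarrow> w \<in> D \<Longrightarrow> F w = (w - z) ^ k z * G z w"
    using F by metis
  obtain V where V: "\<And>z. z \<in> D \<Longrightarrow> V z holomorphic_on D" "\<And>z. z \<in> D \<Longrightarrow> V z z \<noteq> 0"
      "\<And>z w. z \<in> D \<Longrightarrow> w \<in> D \<Longrightarrow> W w = (w - z) ^ k z * V z w"
    using assms(2) unfolding has_orders_def by metis
  define H where "H = (\<lambda>z. G z z / V z z)"
  have local: "H w = G z w / V z w" if "z \<in> D" "w \<in> D" "V z w \<noteq> 0" for z w
  proof (cases "w = z")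
    case False
    then have "W w \<noteq> 0" using V(3)[OF that(1,2)] that(3) by simp
    then have "k w = 0" using has_orders_zero_iff[OF assms(2) that(2)] by simp
    then have "H w = F w / W w" using G(2)[OF that(2,2)] V(3)[OF that(2,2)] by (simp add: H_def)
    also have "\<dots> = G z w / V z w" using False G(2)[OF that(1,2)] V(3)[OF that(1,2)] by simp
    finally show ?thesis .
  qed (simp add: H_def)
  show ?thesis
  proof (rule that)
    show "F w = W w * H w" if "w \<in> D" for w
      using G(2)[OF that that] V(3)[OF that that] V(2)[OF that] by (simp add: H_def)
    show "H holomorphic_on D"
      unfolding holomorphic_on_def
    proof
      fix z assume z: "z \<in> D"
      define U where "U = D \<inter> V z -` (- {0})"
      have "open U"
        unfolding U_def using assms(1) V(1)[OF z]
        by (intro continuous_open_preimage) (auto intro: holomorphic_on_imp_continuous_on)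
      moreover have "z \<in> U" using z V(2)[OF z] by (simp add: U_def)
      moreover have "(\<lambda>w. G z w / V z w) holomorphic_on U"
        using V(1)[OF z] G(1)[OF z]
        by (intro holomorphic_on_divide) (auto simp: U_def elim: holomorphic_on_subset)
      then have "H holomorphic_on U"
        by (rule holomorphic_transform) (use local[OF z] in \<open>auto simp: U_def\<close>)
      ultimately have "H field_differentiable at z"
        using holomorphic_on_imp_differentiable_at by blast
      then show "H field_differentiable at z within D"
        by (rule field_differentiable_at_within)
    qed
  qed
qed

subsection \<open>Domains symmetric under conjugation\<close>

locale symmetric_domain =
  fixes D :: "complex set"
  assumes open_D: "open D" and connected_D: "connected D"
    and cnj_D: "z \<in> D \<Longrightarrow> cnj z \<in> D"
    and real_D: "\<exists>x. complex_of_real x \<in> D"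
begin

text \<open>These are the stem functions of slice preserving functions: compatibility with
  conjugation makes the values obtained from J and from -J agree.\<close>

definition sym :: "(complex \<Rightarrow> complex) \<Rightarrow> bool" where
  "sym F \<longleftrightarrow> F holomorphic_on D \<and> (\<forall>z\<in>D. F (cnj z) = cnj (F z))"

lemma sym_holomorphic: "sym F \<Longrightarrow> F holomorphic_on D"
  and sym_cnj: "sym F \<Longrightarrow> z \<in> D \<Longrightarrow> F (cnj z) = cnj (F z)"
  by (auto simp: sym_def)

lemma sym_const_real: "sym (\<lambda>_. of_real c)"
  by (simp add: sym_def)

lemma sym_const [simp]: "sym (\<lambda>_. 0)" "sym (\<lambda>_. 1)"
  by (simp_all add: sym_def)

lemma sym_id: "sym (\<lambda>z. z)"
  by (simp add: sym_def)

lemma sym_add: "sym F \<Longrightarrow> sym G \<Longrightarrow> sym (\<lambda>z. F z + G z)"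
  and sym_diff: "sym F \<Longrightarrow> sym G \<Longrightarrow> sym (\<lambda>z. F z - G z)"
  and sym_mult: "sym F \<Longrightarrow> sym G \<Longrightarrow> sym (\<lambda>z. F z * G z)"
  and sym_minus: "sym F \<Longrightarrow> sym (\<lambda>z. - F z)"
  and sym_power: "sym F \<Longrightarrow> sym (\<lambda>z. F z ^ n)"
  by (auto simp: sym_def intro!: holomorphic_intros)

lemmas sym_intros = sym_add sym_diff sym_mult sym_minus sym_power sym_id sym_const_real sym_const

lemma sym_real: "sym F \<Longrightarrow> of_real x \<in> D \<Longrightarrow> F (of_real x) \<in> \<real>"
  using sym_cnj[of F "of_real x"] by (simp add: Reals_cnj_iff)

lemma cnj_D_iff [simp]: "cnj z \<in> D \<longleftrightarrow> z \<in> D"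
  using cnj_D[of z] cnj_D[of "cnj z"] by auto

lemma holomorphic_reflection: "F holomorphic_on D \<Longrightarrow> (\<lambda>z. cnj (F (cnj z))) holomorphic_on D"
proof -
  have "cnj ` D = D" unfolding image_cnj_conv_vimage_cnj by auto
  then show "F holomorphic_on D \<Longrightarrow> (\<lambda>z. cnj (F (cnj z))) holomorphic_on D"
    using holomorphic_on_compose_cnj_cnj[of F D] open_D by (simp add: o_def)
qed

text \<open>D is open and contains a real point, so its real points accumulate inside D and the
  identity theorem applies.\<close>

lemma real_identity:
  assumes "F holomorphic_on D" "G holomorphic_on D"
    and eq: "\<And>x. complex_of_real x \<in> D \<Longrightarrow> F (of_real x) = G (of_real x)"
    and "z \<in> D"
  shows "F z = G z"
proof -
  obtain x where x: "complex_of_real x \<in> D" using real_D by blast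
  obtain e where e: "e > 0" "ball (complex_of_real x) e \<subseteq> D"
    using open_D x openE by blast
  have "complex_of_real x islimpt (D \<inter> \<real>)"
    unfolding islimpt_approachable
  proof (intro allI impI)
    fix d :: real assume "d > 0"
    define y where "y = x + min d e / 2"
    have "dist (complex_of_real y) (of_real x) = \<bar>y - x\<bar>"
      unfolding dist_norm of_real_diff[symmetric] norm_of_real ..
    also have "\<dots> = min d e / 2" using e \<open>d > 0\<close> by (simp add: y_def)
    finally have "dist (complex_of_real y) (of_real x) < d" "dist (complex_of_real y) (of_real x) < e"
      "y \<noteq> x"
      using e \<open>d > 0\<close> by (auto simp: y_def)
    then show "\<exists>x'\<in>D \<inter> \<real>. x' \<noteq> complex_of_real x \<and> dist x' (complex_of_real x) < d"
      using e by (intro bexI[of _ "of_real y"]) (auto simp: dist_commute)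
  qed
  moreover have "(\<lambda>z. F z - G z) holomorphic_on D"
    by (intro holomorphic_intros assms)
  moreover have "F w - G w = 0" if "w \<in> D \<inter> \<real>" for w
    using that eq by (auto elim!: Reals_cases)
  ultimately have "F z - G z = 0"
    using analytic_continuation[of "\<lambda>z. F z - G z" D "D \<inter> \<real>" "of_real x" z]
      open_D connected_D x \<open>z \<in> D\<close> by blast
  then show ?thesis by simp
qed

text \<open>Schwarz reflection: F and its reflection agree at the real points, hence on D.\<close>

lemma sym_if_real:
  assumes "F holomorphic_on D" "\<And>x. complex_of_real x \<in> D \<Longrightarrow> F (of_real x) \<in> \<real>"
  shows "sym F"
proof -
  have "cnj (F (cnj z)) = F z" if "z \<in> D" for z
    using holomorphic_reflection[OF assms(1)] assms(1) _ that
    by (rule real_identity) (use assms(2) Reals_cnj_iff in auto)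
  then show ?thesis unfolding sym_def using assms(1) by (metis complex_cnj_cnj)
qed

text \<open>The reflection of H solves the same equation F = M * H, and M can be cancelled.\<close>

lemma sym_quotient:
  assumes "sym F" "sym M" "H holomorphic_on D" "z0 \<in> D" "M z0 \<noteq> 0"
    and eq: "\<And>w. w \<in> D \<Longrightarrow> F w = M w * H w"
  shows "sym H"
proof -
  have "cnj (H (cnj z)) = H z" if "z \<in> D" for z
  proof (rule holomorphic_mult_left_cancel[OF open_D connected_D,
        where M = M and A = "\<lambda>w. cnj (H (cnj w))" and B = H and ?z0.0 = z0])
    fix w assume w: "w \<in> D"
    have "M w * cnj (H (cnj w)) = cnj (M (cnj w) * H (cnj w))"
      using sym_cnj[OF assms(2) w] by simp
    also have "\<dots> = cnj (F (cnj w))" using w eq[of "cnj w"] by simp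
    also have "\<dots> = F w" using sym_cnj[OF assms(1) w] by simp
    finally show "M w * cnj (H (cnj w)) = M w * H w" using eq[OF w] by simp
  qed (use assms that holomorphic_reflection sym_holomorphic in auto)
  then show ?thesis unfolding sym_def using assms(3) by (metis complex_cnj_cnj)
qed

text \<open>The minimal real polynomial of z0. Its real coefficients keep quotients symmetric, and
  its zero at z0 is simple.\<close>

definition root_poly :: "complex \<Rightarrow> complex \<Rightarrow> complex" where
  "root_poly z0 w = (if Im z0 = 0 then w - z0 else (w - z0) * (w - cnj z0))"

lemma root_poly_self [simp]: "root_poly z0 z0 = 0"
  by (simp add: root_poly_def)

lemma root_poly_zero_iff: "root_poly z0 w = 0 \<longleftrightarrow> w = z0 \<or> w = cnj z0"
  using complex_eq_iff[of "cnj z0" z0] by (auto simp: root_poly_def)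

lemma root_poly_factor:
  obtains r where "r holomorphic_on D" "r z0 \<noteq> 0" "\<And>w. root_poly z0 w = (w - z0) * r w"
proof (cases "Im z0 = 0")
  case True
  then show ?thesis using that[of "\<lambda>_. 1"] by (simp add: root_poly_def)
next
  case False
  show ?thesis
    by (rule that[of "\<lambda>w. w - cnj z0"])
      (use False in \<open>auto simp: root_poly_def complex_eq_iff intro!: holomorphic_intros\<close>)
qed

lemma sym_root_poly: "sym (root_poly z0)"
proof (cases "Im z0 = 0")
  case True
  then have "cnj z0 = z0" "root_poly z0 = (\<lambda>w. w - z0)"
    by (auto simp: complex_eq_iff root_poly_def)
  then show ?thesis by (auto simp: sym_def intro!: holomorphic_intros)
next
  case False
  then have "root_poly z0 = (\<lambda>w. (w - z0) * (w - cnj z0))" by (auto simp: root_poly_def)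
  then show ?thesis by (auto simp: sym_def mult.commute intro!: holomorphic_intros)
qed

lemma root_poly_nonzero:
  assumes "z0 \<in> D"
  obtains z1 where "z1 \<in> D" "root_poly z0 z1 \<noteq> 0"
proof -
  have "D \<noteq> {z0, cnj z0}" "D \<noteq> {z0}"
    using open_D assms not_open_singleton finite_imp_not_open[of D] by auto
  then show ?thesis
    using assms cnj_D[OF assms] that unfolding root_poly_zero_iff by auto
qed

text \<open>By symmetry a nonreal zero comes with its conjugate, so that both linear factors can be
  divided out in turn. The quotient inherits the symmetry.\<close>

lemma sym_divide_root:
  assumes F: "sym F" "F z0 = 0" and z0: "z0 \<in> D"
  shows "\<exists>G. sym G \<and> (\<forall>w\<in>D. F w = root_poly z0 w * G w)"
proof -
  have "\<exists>H. H holomorphic_on D \<and> (\<forall>w\<in>D. F w = root_poly z0 w * H w)"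
  proof -
    obtain G where G: "G holomorphic_on D" "\<And>w. w \<in> D \<Longrightarrow> F w = (w - z0) * G w"
      using holomorphic_divide_zero[OF open_D sym_holomorphic[OF F(1)] F(2)] by blast
    show ?thesis
    proof (cases "Im z0 = 0")
      case False
      have "F (cnj z0) = 0" using sym_cnj[OF F(1) z0] F(2) by simp
      then have "G (cnj z0) = 0" using G(2)[of "cnj z0"] z0 False by (auto simp: complex_eq_iff)
      then obtain H where "H holomorphic_on D" "\<And>w. w \<in> D \<Longrightarrow> G w = (w - cnj z0) * H w"
        using holomorphic_divide_zero[OF open_D G(1)] by metis
      then show ?thesis using G(2) False by (auto simp: root_poly_def)
    qed (use G in \<open>auto simp: root_poly_def\<close>)
  qed
  then obtain H where H: "H holomorphic_on D" "\<And>w. w \<in> D \<Longrightarrow> F w = root_poly z0 w * H w" by blast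
  obtain z1 where "z1 \<in> D" "root_poly z0 z1 \<noteq> 0"
    using root_poly_nonzero[OF z0] .
  from sym_quotient[OF F(1) sym_root_poly H(1) this H(2)] show ?thesis using H(2) by blast
qed

text \<open>Take the largest common exponent; the order of the single function \<open>F l1\<close>
  bounds it. If all quotients still vanished at z0, one more root polynomial could be divided
  out.\<close>

lemma common_root_factor:
  assumes F: "\<And>l. sym (F l)" and nz: "z1 \<in> D" "F l1 z1 \<noteq> 0" and z0: "z0 \<in> D"
  shows "\<exists>k G. (\<forall>l. sym (G l)) \<and> (\<forall>l. \<forall>w\<in>D. F l w = root_poly z0 w ^ k * G l w) \<and> (\<exists>l. G l z0 \<noteq> 0)"
proof -
  define Q where "Q = (\<lambda>k. \<exists>G. (\<forall>l. sym (G l)) \<and> (\<forall>l. \<forall>w\<in>D. F l w = root_poly z0 w ^ k * G l w))"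
  obtain n where n: "\<And>j G. G holomorphic_on D \<Longrightarrow> \<forall>w\<in>D. F l1 w = (w - z0) ^ j * G w \<Longrightarrow> j \<le> n"
    using order_bound[OF open_D connected_D sym_holomorphic[OF F] nz z0] by blast
  have bound: "k \<le> n" if "Q k" for k
  proof -
    obtain G where G: "sym (G l1)" "\<forall>w\<in>D. F l1 w = root_poly z0 w ^ k * G l1 w"
      using \<open>Q k\<close> unfolding Q_def by blast
    obtain r where "r holomorphic_on D" "\<And>w. root_poly z0 w = (w - z0) * r w"
      using root_poly_factor by metis
    then show ?thesis
      using G sym_holomorphic[OF G(1)]
      by (intro n[of "\<lambda>w. r w ^ k * G l1 w"]) (auto intro!: holomorphic_intros simp: power_mult_distrib)
  qed
  have "Q 0" unfolding Q_def using F by (intro exI[of _ F]) simp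
  define k where "k = (GREATEST k. Q k)"
  have Qk: "Q k" unfolding k_def by (rule GreatestI_nat[where P = Q, OF \<open>Q 0\<close>]) (use bound in auto)
  have maxk: "j \<le> k" if "Q j" for j unfolding k_def by (rule Greatest_le_nat[where P = Q, OF that]) (use bound in auto)
  obtain G where G: "\<And>l. sym (G l)" "\<And>l w. w \<in> D \<Longrightarrow> F l w = root_poly z0 w ^ k * G l w"
    using Qk unfolding Q_def by blast
  moreover have "\<exists>l. G l z0 \<noteq> 0"
  proof (rule ccontr)
    assume "\<not> ?thesis"
    then have "\<exists>H. sym H \<and> (\<forall>w\<in>D. G l w = root_poly z0 w * H w)" for l
      using sym_divide_root[OF G(1) _ z0] by blast
    then obtain H where "\<And>l. sym (H l)" "\<And>l w. w \<in> D \<Longrightarrow> G l w = root_poly z0 w * H l w"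
      by metis
    then have "Q (Suc k)" unfolding Q_def using G(2) by (intro exI[of _ H]) (auto simp: mult_ac)
    then show False using maxk by fastforce
  qed
  ultimately show ?thesis by blast
qed

text \<open>
  For a Weierstrass product \<open>W\<close> and its reflection \<open>V\<close> the quotient \<open>V / W\<close> has no zeros, hence it is
  a square \<open>e\<^sup>2\<close>; then \<open>W * e\<close> squares to \<open>W * V\<close>, which is nonnegative on the real axis.
\<close>
lemma symmetric_weierstrass:
  assumes sc: "simply_connected D"
    and fin: "\<And>L. compact L \<Longrightarrow> L \<subseteq> D \<Longrightarrow> finite {z\<in>L. k z \<noteq> 0}"
    and k: "\<And>z. z \<in> D \<Longrightarrow> k (cnj z) = k z"
  obtains S where "sym S" "has_orders D S k"
proof -
  \<comment> \<open>The Moebius change of variable needs a base point in D where no zero is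
    prescribed. A closed disc in D has infinitely many points but only finitely many prescribed
    zeros.\<close>
  obtain zs where zs: "zs \<in> D" "k zs = 0"
  proof -
    obtain c r where zr: "r > 0" "cball c r \<subseteq> D"
      using open_D open_contains_cball real_D by blast
    have "infinite (ball c r)"
      using zr(1) finite_imp_not_open[of "ball c r"] by auto
    then have "infinite (cball c r)"
      using finite_subset[OF ball_subset_cball] by blast
    then have "{z\<in>cball c r. k z \<noteq> 0} \<noteq> cball c r"
      using fin[OF compact_cball zr(2)] by metis
    then show ?thesis using that zr(2) by blast
  qed
  obtain W where W: "has_orders D W k"
    unfolding has_orders_def using weierstrass_open_set[OF open_D fin zs] by metis
  define V where "V = (\<lambda>z. cnj (W (cnj z)))"
  have "has_orders D V k"
    unfolding has_orders_def
  proof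
    fix z assume z: "z \<in> D"
    obtain G where G: "G holomorphic_on D" "G (cnj z) \<noteq> 0" "\<And>w. w \<in> D \<Longrightarrow> W w = (w - cnj z) ^ k z * G w"
      using has_ordersE[OF W cnj_D[OF z]] k[OF z] by metis
    then show "\<exists>G. G holomorphic_on D \<and> G z \<noteq> 0 \<and> (\<forall>w\<in>D. V w = (w - z) ^ k z * G w)"
      using holomorphic_reflection[OF G(1)]
      by (intro exI[of _ "\<lambda>z. cnj (G (cnj z))"]) (auto simp: V_def)
  qed
  have "\<exists>G. G holomorphic_on D \<and> (\<forall>w\<in>D. V w = (w - z) ^ k z * G w)" if "z \<in> D" for z
    using has_ordersE[OF \<open>has_orders D V k\<close> that] by metis
  then obtain q where q: "q holomorphic_on D" "\<And>w. w \<in> D \<Longrightarrow> V w = W w * q w"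
    using holomorphic_quotient[OF open_D W, of V] by metis
  have q0: "q z \<noteq> 0" if z: "z \<in> D" for z
  proof
    assume "q z = 0"
    obtain G where G: "G holomorphic_on D" "G z \<noteq> 0" "\<And>w. w \<in> D \<Longrightarrow> W w = (w - z) ^ k z * G w"
      using has_ordersE[OF W z] by blast
    obtain H where H: "H holomorphic_on D" "H z \<noteq> 0" "\<And>w. w \<in> D \<Longrightarrow> V w = (w - z) ^ k z * H w"
      using has_ordersE[OF \<open>has_orders D V k\<close> z] by blast
    have "H z = G z * q z"
    proof (rule power_mult_left_cancel[OF open_D H(1) _ _ z, where H = "\<lambda>w. G w * q w"])
      show "(\<lambda>w. G w * q w) holomorphic_on D" by (intro holomorphic_intros G q)
      show "(w - z) ^ k z * H w = (w - z) ^ k z * (G w * q w)" if "w \<in> D" for w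
        using G(3)[OF that] H(3)[OF that] q(2)[OF that] by (metis mult.assoc)
    qed
    with H(2) \<open>q z = 0\<close> show False by simp
  qed
  obtain e where e: "e holomorphic_on D" "\<And>z. z \<in> D \<Longrightarrow> q z = (e z)\<^sup>2"
    using sc q(1) q0 unfolding simply_connected_eq_holomorphic_sqrt[OF open_D] by blast
  have "has_orders D (\<lambda>z. W z * e z) (\<lambda>z. k z + 0)"
  proof (rule has_orders_mult[OF W])
    show "has_orders D e (\<lambda>_. 0)" unfolding has_orders_def
    proof
      fix z assume "z \<in> D"
      then show "\<exists>G. G holomorphic_on D \<and> G z \<noteq> 0 \<and> (\<forall>w\<in>D. e w = (w - z) ^ 0 * G w)"
        using e q0[of z] by (intro exI[of _ e]) auto
    qed
  qed
  moreover have "sym (\<lambda>z. W z * e z)"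
  proof (rule sym_if_real)
    show "(\<lambda>z. W z * e z) holomorphic_on D"
      using has_orders_holomorphic[OF W] e by (intro holomorphic_intros)
    fix x assume x: "complex_of_real x \<in> D"
    have "(W x * e x)\<^sup>2 = W x * V x" using e(2)[OF x] q(2)[OF x] by (simp add: power2_eq_square)
    also have "\<dots> = of_real ((norm (W x))\<^sup>2)" by (simp add: V_def complex_norm_square[symmetric] del: of_real_power)
    also have "\<dots> = (of_real (norm (W x)))\<^sup>2" by simp
    finally have "W x * e x = of_real (norm (W x)) \<or> W x * e x = - of_real (norm (W x))"
      by (simp only: power2_eq_iff)
    then show "W x * e x \<in> \<real>" by auto
  qed
  ultimately show ?thesis using that by simp
qed

end

subsection \<open>Slices of the quaternions\<close>

lemma quat_of_real_simps [simp]: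
  "qRe (of_real x) = x" "qIm1 (of_real x) = 0" "qIm2 (of_real x) = 0" "qIm3 (of_real x) = 0"
  by (simp_all add: of_real_def)

lemma quat_unit_simps [simp]:
  "qRe quat_i = 0" "qIm1 quat_i = 1" "qIm2 quat_i = 0" "qIm3 quat_i = 0"
  "qRe quat_j = 0" "qIm1 quat_j = 0" "qIm2 quat_j = 1" "qIm3 quat_j = 0"
  "qRe quat_k = 0" "qIm1 quat_k = 0" "qIm2 quat_k = 0" "qIm3 quat_k = 1"
  by (simp_all add: quat_i_def quat_j_def quat_k_def)

lemma quat_coord_bound:
  "\<bar>qRe q\<bar> \<le> norm q" "\<bar>qIm1 q\<bar> \<le> norm q" "\<bar>qIm2 q\<bar> \<le> norm q" "\<bar>qIm3 q\<bar> \<le> norm q"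
  unfolding norm_quat_def by (auto intro!: real_le_rsqrt)

lemma bounded_linear_quat_coord:
  "bounded_linear qRe" "bounded_linear qIm1" "bounded_linear qIm2" "bounded_linear qIm3"
  by (rule bounded_linear_intro[where K = 1]; use quat_coord_bound in simp)+

lemma imag_units_iff:
  "J \<in> imag_units \<longleftrightarrow> qRe J = 0 \<and> (qIm1 J)\<^sup>2 + (qIm2 J)\<^sup>2 + (qIm3 J)\<^sup>2 = 1"
proof
  assume "J \<in> imag_units"
  then have eq: "qRe J * qRe J - qIm1 J * qIm1 J - qIm2 J * qIm2 J - qIm3 J * qIm3 J = -1"
    "qRe J * qIm1 J = 0" "qRe J * qIm2 J = 0" "qRe J * qIm3 J = 0"
    by (auto simp: imag_units_def quat_eq_iff power2_eq_square)
  have "qRe J = 0"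
  proof (rule ccontr)
    assume "qRe J \<noteq> 0"
    then have "qIm1 J = 0" "qIm2 J = 0" "qIm3 J = 0" using eq by auto
    then have "qRe J * qRe J = -1" using eq(1) by simp
    then show False using zero_le_square[of "qRe J"] by linarith
  qed
  then show "qRe J = 0 \<and> (qIm1 J)\<^sup>2 + (qIm2 J)\<^sup>2 + (qIm3 J)\<^sup>2 = 1"
    using eq(1) by (simp add: power2_eq_square)
qed (auto simp: imag_units_def quat_eq_iff power2_eq_square)

lemma imag_unit_square: "J \<in> imag_units \<Longrightarrow> J * J = -1"
  by (simp add: imag_units_def power2_eq_square)

lemma imag_unit_square_left: "J \<in> imag_units \<Longrightarrow> J * (J * x) = - x"
  by (simp add: imag_unit_square flip: mult.assoc)

lemma imag_unit_norm: "J \<in> imag_units \<Longrightarrow> norm J = 1"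
  by (simp add: imag_units_iff norm_quat_def)

lemma imag_units_uminus: "J \<in> imag_units \<Longrightarrow> - J \<in> imag_units"
  by (simp add: imag_units_iff)

lemma quat_i_imag_unit [simp]: "quat_i \<in> imag_units"
  by (simp add: imag_units_iff)

definition slice_embed :: "quat \<Rightarrow> complex \<Rightarrow> quat" where
  "slice_embed J z = of_real (Re z) + J * of_real (Im z)"

lemma slice_embed_scaleR: "slice_embed J z = Re z *\<^sub>R 1 + Im z *\<^sub>R J"
  by (simp add: slice_embed_def of_real_def)

lemma slice_embed_simps [simp]:
  "slice_embed J 0 = 0" "slice_embed J 1 = 1" "slice_embed J (of_real x) = of_real x"
  "slice_embed J \<i> = J"
  by (simp_all add: slice_embed_def)

lemma qRe_slice_embed: "J \<in> imag_units \<Longrightarrow> qRe (slice_embed J z) = Re z"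
  by (simp add: slice_embed_scaleR imag_units_iff)

lemma slice_embed_add: "slice_embed J (z + w) = slice_embed J z + slice_embed J w"
  and slice_embed_diff: "slice_embed J (z - w) = slice_embed J z - slice_embed J w"
  and slice_embed_minus: "slice_embed J (- z) = - slice_embed J z"
  by (simp_all add: slice_embed_def algebra_simps)

lemma slice_embed_cnj: "slice_embed J (cnj z) = slice_embed (- J) z"
  by (simp add: slice_embed_def)

lemma slice_embed_mult:
  assumes "J \<in> imag_units"
  shows "slice_embed J (z * w) = slice_embed J z * slice_embed J w"
  by (simp add: slice_embed_scaleR algebra_simps imag_unit_square[OF assms])

lemma slice_embed_power:
  assumes "J \<in> imag_units"
  shows "slice_embed J (z ^ n) = slice_embed J z ^ n"
  by (induction n) (simp_all add: slice_embed_mult[OF assms])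

lemma slice_embed_commute:
  assumes "J \<in> imag_units"
  shows "slice_embed J z * slice_embed J w = slice_embed J w * slice_embed J z"
  by (simp add: mult.commute flip: slice_embed_mult[OF assms])

lemma norm_slice_embed:
  assumes "J \<in> imag_units"
  shows "norm (slice_embed J z) = norm z"
proof -
  have "(Re z)\<^sup>2 + (Im z * qIm1 J)\<^sup>2 + (Im z * qIm2 J)\<^sup>2 + (Im z * qIm3 J)\<^sup>2
      = (Re z)\<^sup>2 + (Im z)\<^sup>2 * ((qIm1 J)\<^sup>2 + (qIm2 J)\<^sup>2 + (qIm3 J)\<^sup>2)"
    by (simp add: algebra_simps power_mult_distrib)
  also have "\<dots> = (Re z)\<^sup>2 + (Im z)\<^sup>2"
    using assms by (simp add: imag_units_iff)
  finally show ?thesis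
    using assms by (simp add: norm_quat_def slice_embed_scaleR imag_units_iff cmod_def)
qed

lemma slice_embed_eq_0_iff: "J \<in> imag_units \<Longrightarrow> slice_embed J z = 0 \<longleftrightarrow> z = 0"
  by (metis norm_slice_embed norm_eq_zero)

lemma bounded_linear_slice_embed: "bounded_linear (slice_embed J)"
  unfolding slice_embed_scaleR[abs_def]
  by (intro bounded_linear_add bounded_linear_scaleR_const bounded_linear_Re bounded_linear_Im)

lemma slice_embed_surj: "\<exists>J\<in>imag_units. \<exists>z. q = slice_embed J z"
proof -
  define v where "v = q - of_real (qRe q)"
  show ?thesis
  proof (cases "v = 0")
    case True
    then show ?thesis
      by (intro bexI[of _ quat_i] exI[of _ "of_real (qRe q)"]) (auto simp: v_def)
  next
    case False
    have "(qIm1 v)\<^sup>2 + (qIm2 v)\<^sup>2 + (qIm3 v)\<^sup>2 = (norm v)\<^sup>2"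
      by (simp add: norm_quat_def v_def)
    then have "v /\<^sub>R norm v \<in> imag_units"
      using False
      by (simp add: imag_units_iff v_def power_mult_distrib flip: distrib_left)
        (simp add: divide_simps)
    moreover have "q = slice_embed (v /\<^sub>R norm v) (Complex (qRe q) (norm v))"
      using False by (simp add: slice_embed_scaleR v_def flip: of_real_def)
    ultimately show ?thesis by blast
  qed
qed

lemma slice_plane_eq: "slice_plane J = range (slice_embed J)"
proof -
  have "x \<in> span {1, J} \<longleftrightarrow> (\<exists>a b. x = a *\<^sub>R 1 + b *\<^sub>R J)" for x
    by (auto simp: span_insert span_singleton) (metis add.commute diff_eq_eq)+
  moreover have "(\<exists>a b. x = a *\<^sub>R 1 + b *\<^sub>R J) \<longleftrightarrow> x \<in> range (slice_embed J)" for x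
    by (auto simp: slice_embed_scaleR image_iff) (metis complex.sel)
  ultimately show ?thesis unfolding slice_plane_def by blast
qed

section \<open>Coordinates of quaternions and the Cauchy-Riemann equation on a slice\<close>

datatype qidx = Q0 | Q1 | Q2 | Q3

lemma qidx_all: "(\<forall>l. P l) \<longleftrightarrow> P Q0 \<and> P Q1 \<and> P Q2 \<and> P Q3"
  by (metis qidx.exhaust)

primrec qcoord :: "qidx \<Rightarrow> quat \<Rightarrow> real" where
  "qcoord Q0 = qRe" | "qcoord Q1 = qIm1" | "qcoord Q2 = qIm2" | "qcoord Q3 = qIm3"

text \<open>Coefficients stand to the left of the units, as in the slice decomposition, so that left
  multiplication passes through the combination.\<close>

definition quat_comb :: "(qidx \<Rightarrow> quat) \<Rightarrow> quat" where
  "quat_comb a = a Q0 + a Q1 * quat_i + a Q2 * quat_j + a Q3 * quat_k"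

lemma quat_comb_of_real: "quat_comb (\<lambda>l. of_real (a l)) = Quat (a Q0) (a Q1) (a Q2) (a Q3)"
  by (simp add: quat_comb_def quat_eq_iff)

lemma quat_comb_qcoord: "quat_comb (\<lambda>l. of_real (qcoord l q)) = q"
  by (simp add: quat_comb_of_real)

lemma quat_comb_slice_embed:
  "quat_comb (\<lambda>l. slice_embed J (a l)) = quat_comb (\<lambda>l. of_real (Re (a l))) + J * quat_comb (\<lambda>l. of_real (Im (a l)))"
  by (simp add: quat_comb_def slice_embed_def algebra_simps)

lemma quat_comb_mult_left: "quat_comb (\<lambda>l. x * a l) = x * quat_comb a"
  by (simp add: quat_comb_def algebra_simps)

lemma bounded_linear_qcoord: "bounded_linear (qcoord l)"
  by (cases l) (simp_all add: bounded_linear_quat_coord)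

text \<open>Turns left multiplication by J into multiplication by the complex unit, while the real
  part stays the ordinary coordinate; these two demands force the imaginary part. Slice regular
  functions thus get holomorphic coordinates.\<close>

definition slice_coord :: "quat \<Rightarrow> qidx \<Rightarrow> quat \<Rightarrow> complex" where
  "slice_coord J l x = of_real (qcoord l x) - \<i> * of_real (qcoord l (J * x))"

lemma bounded_linear_slice_coord: "bounded_linear (slice_coord J l)"
  unfolding slice_coord_def[abs_def]
  by (intro bounded_linear_sub bounded_linear_const_mult
      bounded_linear_compose[OF bounded_linear_of_real]
      bounded_linear_qcoord bounded_linear_compose[OF bounded_linear_qcoord] bounded_linear_mult_right)

lemma qcoord_uminus: "qcoord l (- x) = - qcoord l x"
  by (cases l) simp_all

lemma slice_coord_mult:
  "J \<in> imag_units \<Longrightarrow> slice_coord J l (J * x) = \<i> * slice_coord J l x"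
  by (simp add: slice_coord_def imag_unit_square_left qcoord_uminus algebra_simps)

lemma Re_slice_coord: "Re (slice_coord J l x) = qcoord l x"
  by (simp add: slice_coord_def)

text \<open>The pair of real variables and the complex variable differ by a real linear isomorphism,
  under which (1, 0) and (0, 1) become 1 and the complex unit.\<close>

lemma slice_regular_iff:
  "f \<in> slice_regular \<Omega> \<longleftrightarrow> (\<forall>J\<in>imag_units. \<forall>z. slice_embed J z \<in> \<Omega> \<longrightarrow>
     (\<exists>f'. ((\<lambda>z. f (slice_embed J z)) has_derivative f') (at z) \<and> f' 1 + J * f' \<i> = 0))"
proof -
  have "(\<exists>D. ((\<lambda>(a, b). f (of_real a + J * of_real b)) has_derivative D) (at (\<alpha>, \<beta>)) \<and>
          (1/2) *\<^sub>R (D (1, 0) + J * D (0, 1)) = 0) \<longleftrightarrow>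
        (\<exists>f'. ((\<lambda>z. f (slice_embed J z)) has_derivative f') (at (Complex \<alpha> \<beta>)) \<and> f' 1 + J * f' \<i> = 0)"
    for J \<alpha> \<beta>
  proof safe
    fix D assume D: "((\<lambda>(a, b). f (of_real a + J * of_real b)) has_derivative D) (at (\<alpha>, \<beta>))"
      "(1/2) *\<^sub>R (D (1, 0) + J * D (0, 1)) = 0"
    have "((\<lambda>z. (Re z, Im z)) has_derivative (\<lambda>z. (Re z, Im z))) (at (Complex \<alpha> \<beta>))"
      by (auto intro!: derivative_eq_intros)
    from has_derivative_compose[OF this, of "\<lambda>(a, b). f (of_real a + J * of_real b)" D] D
    show "\<exists>f'. ((\<lambda>z. f (slice_embed J z)) has_derivative f') (at (Complex \<alpha> \<beta>)) \<and> f' 1 + J * f' \<i> = 0"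
      by (intro exI[of _ "\<lambda>z. D (Re z, Im z)"]) (auto simp: slice_embed_def)
  next
    fix f' assume f': "((\<lambda>z. f (slice_embed J z)) has_derivative f') (at (Complex \<alpha> \<beta>))"
      "f' 1 + J * f' \<i> = 0"
    have "((\<lambda>p. of_real (fst p) + \<i> * of_real (snd p)) has_derivative
        (\<lambda>p. of_real (fst p) + \<i> * of_real (snd p))) (at (\<alpha>, \<beta>))"
      by (auto intro!: derivative_eq_intros)
    from has_derivative_compose[OF this, of "\<lambda>z. f (slice_embed J z)" f'] f'
    show "\<exists>D. ((\<lambda>(a, b). f (of_real a + J * of_real b)) has_derivative D) (at (\<alpha>, \<beta>)) \<and>
          (1/2) *\<^sub>R (D (1, 0) + J * D (0, 1)) = 0"
      by (intro exI[of _ "\<lambda>p. f' (of_real (fst p) + \<i> * of_real (snd p))"])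
        (auto simp: slice_embed_def case_prod_unfold Complex_eq)
  qed
  note eq = this
  have all: "(\<forall>z. P z) \<longleftrightarrow> (\<forall>a b. P (Complex a b))" for P
    by (metis complex.collapse)
  show ?thesis
    unfolding slice_regular_def mem_Collect_eq all
    by (intro ball_cong refl all_cong1 imp_cong eq) (simp add: slice_embed_def)
qed

subsection \<open>Stem functions\<close>

text \<open>By the symmetry of the domain every unit yields the same set, see
  \<open>slice_embed_mem_iff\<close>; \<open>quat_i\<close> is an arbitrary choice.\<close>

definition stem_domain :: "quat set \<Rightarrow> complex set" where
  "stem_domain \<Omega> = {z. slice_embed quat_i z \<in> \<Omega>}"

locale slice_domain =
  fixes \<Omega> :: "quat set" and I\<^sub>0 :: quat
  assumes ssd: "symmetric_slice_domain \<Omega>"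
    and unit: "I\<^sub>0 \<in> imag_units"
    and simply_connected_slice: "simply_connected (\<Omega> \<inter> slice_plane I\<^sub>0)"
begin

abbreviation D :: "complex set" where "D \<equiv> stem_domain \<Omega>"

lemma slice_embed_mem_iff:
  assumes "J \<in> imag_units"
  shows "slice_embed J z \<in> \<Omega> \<longleftrightarrow> z \<in> D"
proof -
  have "slice_embed K z \<in> \<Omega>" if "slice_embed J z \<in> \<Omega>" "J \<in> imag_units" "K \<in> imag_units" for J K
  proof -
    have "quat_sphere (Re z) (Im z) \<subseteq> \<Omega>"
      using ssd that unfolding symmetric_slice_domain_def slice_embed_def by blast
    then show ?thesis using that unfolding quat_sphere_def slice_embed_def by blast
  qed
  then show ?thesis unfolding stem_domain_def using assms quat_i_imag_unit by blast
qed

lemma slice_embed_cases: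
  assumes "q \<in> \<Omega>"
  obtains J z where "J \<in> imag_units" "z \<in> D" "q = slice_embed J z"
  using slice_embed_surj[of q] slice_embed_mem_iff assms by blast

lemma of_real_mem_iff: "complex_of_real x \<in> D \<longleftrightarrow> of_real x \<in> \<Omega>"
  using slice_embed_mem_iff[OF quat_i_imag_unit, of "of_real x"] by simp

lemma simply_connected_stem_domain: "simply_connected D"
proof -
  have linear_stem: "bounded_linear (\<lambda>q. - qRe (I\<^sub>0 * q))"
    by (intro bounded_linear_minus bounded_linear_compose[OF bounded_linear_quat_coord(1)]
        bounded_linear_mult_right)
  \<comment> \<open>For \<open>q = x + I\<^sub>0 * y\<close> with real x and y, the real part of
    \<open>I\<^sub>0 * q\<close> is -y, so g inverts the embedding of the slice.\<close>
  define g where "g = (\<lambda>q. Complex (qRe q) (- qRe (I\<^sub>0 * q)))"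
  have inv: "g (slice_embed I\<^sub>0 z) = z" for z
    unfolding g_def using arg_cong[OF slice_embed_mult[OF unit, of \<i> z], of qRe]
    by (simp add: complex_eq_iff qRe_slice_embed[OF unit] del: quat_mult_simps)
  have "D homeomorphic (\<Omega> \<inter> slice_plane I\<^sub>0)"
  proof (rule homeomorphicI[where f = "slice_embed I\<^sub>0" and g = g])
    show "slice_embed I\<^sub>0 ` D = \<Omega> \<inter> slice_plane I\<^sub>0"
      using slice_embed_mem_iff[OF unit] by (auto simp: slice_plane_eq)
    then show "g ` (\<Omega> \<inter> slice_plane I\<^sub>0) = D"
      by (auto simp: image_image inv simp flip: \<open>slice_embed I\<^sub>0 ` D = _\<close>)
    show "continuous_on D (slice_embed I\<^sub>0)"
      by (intro linear_continuous_on bounded_linear_slice_embed)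
    show "continuous_on (\<Omega> \<inter> slice_plane I\<^sub>0) g"
      unfolding g_def
      by (intro continuous_on_Complex linear_continuous_on[OF linear_stem]
          linear_continuous_on[OF bounded_linear_quat_coord(1)])
  qed (auto simp: inv slice_plane_eq)
  then show ?thesis
    using homeomorphic_simply_connected_eq simply_connected_slice by blast
qed

sublocale symmetric_domain D
proof
  have "open (slice_embed quat_i -` \<Omega>)"
    using ssd
    by (intro open_vimage linear_continuous_on bounded_linear_slice_embed)
      (simp add: symmetric_slice_domain_def)
  then show "open D" by (simp add: stem_domain_def vimage_def)
  show "connected D"
    using simply_connected_stem_domain by (rule simply_connected_imp_connected)
  show "cnj z \<in> D" if "z \<in> D" for z
    using that slice_embed_mem_iff[OF imag_units_uminus[OF quat_i_imag_unit]]
      slice_embed_mem_iff[OF quat_i_imag_unit, of "cnj z"] slice_embed_cnj by metis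
  obtain q where "q \<in> \<Omega>" "q \<in> \<real>" using ssd unfolding symmetric_slice_domain_def by blast
  then show "\<exists>x. complex_of_real x \<in> D"
    using of_real_mem_iff by (auto elim!: Reals_cases)
qed

text \<open>The slice equation says that f' at the complex unit is J times f' at 1. After
  \<open>slice_coord\<close> this makes the real derivative complex linear.\<close>

lemma holomorphic_slice_coord:
  assumes "f \<in> slice_regular \<Omega>" "J \<in> imag_units"
  shows "(\<lambda>z. slice_coord J l (f (slice_embed J z))) holomorphic_on D"
  unfolding holomorphic_on_def
proof
  fix z assume "z \<in> D"
  then obtain f' where f': "((\<lambda>z. f (slice_embed J z)) has_derivative f') (at z)" "f' 1 + J * f' \<i> = 0"
    using assms slice_embed_mem_iff[OF assms(2), of z] unfolding slice_regular_iff by blast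
  have der: "((\<lambda>z. slice_coord J l (f (slice_embed J z))) has_derivative (\<lambda>w. slice_coord J l (f' w))) (at z)"
    by (rule bounded_linear.has_derivative[OF bounded_linear_slice_coord f'(1)])
  have "J * f' 1 = f' \<i>"
    using arg_cong[OF f'(2), of "\<lambda>x. J * x"] by (simp add: algebra_simps imag_unit_square_left[OF assms(2)])
  then have i: "slice_coord J l (f' \<i>) = \<i> * slice_coord J l (f' 1)"
    using slice_coord_mult[OF assms(2), of l "f' 1"] by simp
  have "slice_coord J l (f' w) = slice_coord J l (f' 1) * w" for w
  proof -
    interpret L: bounded_linear "\<lambda>w. slice_coord J l (f' w)"
      using der by (rule has_derivative_bounded_linear)
    have "slice_coord J l (f' (Re w *\<^sub>R 1 + Im w *\<^sub>R \<i>))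
        = Re w *\<^sub>R slice_coord J l (f' 1) + Im w *\<^sub>R slice_coord J l (f' \<i>)"
      by (simp only: L.add L.scaleR)
    moreover have "Re w *\<^sub>R 1 + Im w *\<^sub>R \<i> = w" by (simp add: complex_eq_iff)
    moreover have "Re w *\<^sub>R c + Im w *\<^sub>R (\<i> * c) = c * w" for c
      by (simp add: complex_eq_iff algebra_simps)
    ultimately show ?thesis by (simp add: i)
  qed
  then have "(\<lambda>w. slice_coord J l (f' w)) = (*) (slice_coord J l (f' 1))"
    by (rule ext)
  then have "((\<lambda>z. slice_coord J l (f (slice_embed J z))) has_field_derivative slice_coord J l (f' 1)) (at z)"
    using der unfolding has_field_derivative_def by (simp only:)
  then show "(\<lambda>z. slice_coord J l (f (slice_embed J z))) field_differentiable at z within D"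
    using field_differentiable_at_within field_differentiable_def by blast
qed

text \<open>Each slice reduces to \<open>real_identity\<close> for the slice coordinates, whose real
  parts recover the quaternion.\<close>

lemma slice_identity_principle:
  assumes "f \<in> slice_regular \<Omega>" "g \<in> slice_regular \<Omega>"
    and eq: "\<And>x. of_real x \<in> \<Omega> \<Longrightarrow> f (of_real x) = g (of_real x)"
    and "q \<in> \<Omega>"
  shows "f q = g q"
proof -
  obtain J z where Jz: "J \<in> imag_units" "z \<in> D" "q = slice_embed J z"
    using slice_embed_cases[OF \<open>q \<in> \<Omega>\<close>] .
  have "slice_coord J l (f (slice_embed J z)) = slice_coord J l (g (slice_embed J z))" for l
    by (rule real_identity[OF holomorphic_slice_coord[OF assms(1) Jz(1)]
          holomorphic_slice_coord[OF assms(2) Jz(1)] _ Jz(2)])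
      (simp add: eq of_real_mem_iff)
  then have "Re (slice_coord J l (f q)) = Re (slice_coord J l (g q))" for l
    by (simp only: Jz(3))
  then have "qcoord l (f q) = qcoord l (g q)" for l
    unfolding Re_slice_coord .
  from this[of Q0] this[of Q1] this[of Q2] this[of Q3] show ?thesis by (simp add: quat_eq_iff)
qed

text \<open>An increment multiplied by the complex unit changes every coefficient by a left factor
  J. This factor can be pulled out of the combination, which is the slice equation.\<close>

lemma slice_regularI:
  assumes hol: "\<And>l. F l holomorphic_on D"
    and eq: "\<And>J z. J \<in> imag_units \<Longrightarrow> z \<in> D \<Longrightarrow> f (slice_embed J z) = quat_comb (\<lambda>l. slice_embed J (F l z))"
  shows "f \<in> slice_regular \<Omega>"
  unfolding slice_regular_iff
proof (intro ballI allI impI)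
  fix J z assume J: "J \<in> imag_units" and "slice_embed J z \<in> \<Omega>"
  then have z: "z \<in> D" by (simp add: slice_embed_mem_iff)
  define f' where "f' = (\<lambda>w. quat_comb (\<lambda>l. slice_embed J (deriv (F l) z * w)))"
  have F': "(F l has_derivative (\<lambda>w. deriv (F l) z * w)) (at z)" for l
    using holomorphic_derivI[OF hol open_D z] by (simp add: has_field_derivative_def)
  have "((\<lambda>z. quat_comb (\<lambda>l. slice_embed J (F l z))) has_derivative f') (at z)"
    unfolding quat_comb_def f'_def
    by (intro has_derivative_add has_derivative_mult_left
        bounded_linear.has_derivative[OF bounded_linear_slice_embed] F')
  then have "((\<lambda>z. f (slice_embed J z)) has_derivative f') (at z)"
    by (rule has_derivative_transform_within_open[OF _ open_D z]) (simp add: eq[OF J])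
  moreover have "f' 1 + J * f' \<i> = 0"
  proof -
    have "f' \<i> = J * f' 1"
      unfolding f'_def quat_comb_mult_left[symmetric]
      by (simp add: slice_embed_mult[OF J] slice_embed_commute[OF J, of _ \<i>, simplified])
    then show ?thesis by (simp add: imag_unit_square_left[OF J])
  qed
  ultimately show "\<exists>f'. ((\<lambda>z. f (slice_embed J z)) has_derivative f') (at z) \<and> f' 1 + J * f' \<i> = 0"
    by blast
qed

text \<open>At a real point the scalar factor \<open>1 / s\<close> is \<open>1 / 0 = 0\<close>, which drops the imaginary part.\<close>
definition slice_ext :: "(complex \<Rightarrow> complex) \<Rightarrow> quat \<Rightarrow> quat" where
  "slice_ext G q = (let v = q - of_real (qRe q); s = norm v; w = G (Complex (qRe q) s)
     in Re w *\<^sub>R 1 + (Im w / s) *\<^sub>R v)"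

text \<open>The extension evaluates G only in the closed upper half plane. For negative
  \<open>Im z\<close> the unit changes sign and conjugation compensates; at a real z symmetry makes
  \<open>G z\<close> real, so that nothing is lost there.\<close>

lemma slice_ext_embed:
  assumes G: "sym G" and J: "J \<in> imag_units" and z: "z \<in> D"
  shows "slice_ext G (slice_embed J z) = slice_embed J (G z)"
proof -
  note re = qRe_slice_embed[OF J]
  have v: "slice_embed J z - of_real (Re z) = Im z *\<^sub>R J"
    by (simp add: slice_embed_scaleR of_real_def)
  have s: "norm (Im z *\<^sub>R J) = \<bar>Im z\<bar>" using imag_unit_norm[OF J] by simp
  have ext: "slice_ext G (slice_embed J z) = Re (G (Complex (Re z) \<bar>Im z\<bar>)) *\<^sub>R 1
      + (Im (G (Complex (Re z) \<bar>Im z\<bar>)) / \<bar>Im z\<bar>) *\<^sub>R (Im z *\<^sub>R J)"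
    unfolding slice_ext_def Let_def re v s ..
  consider "Im z > 0" | "Im z = 0" | "Im z < 0" by linarith
  then show ?thesis
  proof cases
    case 1
    then show ?thesis
      by (simp add: ext slice_embed_scaleR[of J "G z"])
  next
    case 2
    then have "z = of_real (Re z)" by (simp add: complex_eq_iff)
    then have "Im (G z) = 0" using sym_real[OF G, of "Re z"] z by (simp add: complex_is_Real_iff)
    moreover have "Complex (Re z) \<bar>Im z\<bar> = z" using 2 by (simp add: complex_eq_iff)
    ultimately show ?thesis using 2
      by (simp add: ext slice_embed_scaleR[of J "G z"])
  next
    case 3
    then have "Complex (Re z) \<bar>Im z\<bar> = cnj z" by (simp add: complex_eq_iff)
    then show ?thesis using 3 sym_cnj[OF G z]
      by (simp add: ext slice_embed_scaleR[of J "G z"])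
  qed
qed

definition stem_ext :: "(qidx \<Rightarrow> complex \<Rightarrow> complex) \<Rightarrow> quat \<Rightarrow> quat" where
  "stem_ext F q = quat_comb (\<lambda>l. slice_ext (F l) q)"

lemma stem_ext_embed:
  assumes "\<And>l. sym (F l)" "J \<in> imag_units" "z \<in> D"
  shows "stem_ext F (slice_embed J z) = quat_comb (\<lambda>l. slice_embed J (F l z))"
  by (simp add: stem_ext_def slice_ext_embed assms)

lemma stem_ext_regular: "(\<And>l. sym (F l)) \<Longrightarrow> stem_ext F \<in> slice_regular \<Omega>"
  by (rule slice_regularI[of F]) (simp_all add: stem_ext_embed sym_holomorphic)

lemma slice_ext_preserving:
  assumes "sym G"
  shows "slice_ext G \<in> slice_preserving \<Omega>"
proof -
  have "slice_ext G \<in> slice_regular \<Omega>"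
    by (rule slice_regularI[of "\<lambda>l. if l = Q0 then G else (\<lambda>_. 0)"])
      (use assms in \<open>auto simp: slice_ext_embed quat_comb_def sym_holomorphic\<close>)
  moreover have "slice_ext G q \<in> slice_plane I" if "I \<in> imag_units" "q \<in> \<Omega>" "q \<in> slice_plane I" for I q
    using that by (auto simp: slice_plane_eq slice_embed_mem_iff slice_ext_embed[OF assms])
  ultimately show ?thesis unfolding slice_preserving_def by blast
qed

lemma stem_ext_real:
  assumes "\<And>l. sym (F l)" "of_real x \<in> \<Omega>"
  shows "stem_ext F (of_real x) = quat_comb (\<lambda>l. of_real (Re (F l (of_real x))))"
proof -
  have x: "complex_of_real x \<in> D" using assms(2) by (simp add: of_real_mem_iff)
  have "F l (of_real x) = of_real (Re (F l (of_real x)))" for l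
    using sym_real[OF assms(1) x, of l] by simp
  then have "slice_embed quat_i (F l (of_real x)) = of_real (Re (F l (of_real x)))" for l
    by (metis slice_embed_simps(3))
  then show ?thesis
    using stem_ext_embed[of F quat_i "of_real x"] assms(1) x by simp
qed

lemma qcoord_quat_comb_of_real: "qcoord l (quat_comb (\<lambda>l. of_real (a l))) = a l"
  by (cases l) (simp_all add: quat_comb_of_real)

lemma qcoord_stem_ext_real:
  assumes "\<And>l. sym (F l)" "of_real x \<in> \<Omega>"
  shows "qcoord l (stem_ext F (of_real x)) = Re (F l (of_real x))"
  using stem_ext_real[OF assms] by (simp only: qcoord_quat_comb_of_real)

text \<open>At a real point the values \<open>F l\<close> are real and hence are the coordinates of
  the quaternion; \<open>real_identity\<close> does the rest.\<close>

lemma stem_unique: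
  assumes "\<And>l. sym (F l)" "\<And>l. sym (G l)" "\<And>q. q \<in> \<Omega> \<Longrightarrow> stem_ext F q = stem_ext G q" "z \<in> D"
  shows "F l z = G l z"
proof (rule real_identity[OF _ _ _ \<open>z \<in> D\<close>])
  fix x assume x: "complex_of_real x \<in> D"
  then have "stem_ext F (of_real x) = stem_ext G (of_real x)" using assms(3) of_real_mem_iff by blast
  then have "Re (F l (of_real x)) = Re (G l (of_real x))"
    using qcoord_stem_ext_real[where F = F, OF assms(1), of x l] qcoord_stem_ext_real[where F = G, OF assms(2), of x l] x
    by (simp add: of_real_mem_iff)
  moreover have "F l (of_real x) \<in> \<real>" "G l (of_real x) \<in> \<real>"
    using assms x sym_real by blast+
  ultimately show "F l (of_real x) = G l (of_real x)" by (metis of_real_Re)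
qed (use assms sym_holomorphic in auto)

text \<open>The stem functions must prolong the real coordinates of f from the real axis. The slice
  coordinates on the slice of i are holomorphic and have the right real parts there, and averaging
  with the reflection removes their imaginary parts on the axis.\<close>

lemma stem_exists:
  assumes f: "f \<in> slice_regular \<Omega>"
  obtains F where "\<And>l. sym (F l)" "\<And>q. q \<in> \<Omega> \<Longrightarrow> f q = stem_ext F q"
proof -
  define H where "H = (\<lambda>l z. slice_coord quat_i l (f (slice_embed quat_i z)))"
  have H: "H l holomorphic_on D" for l
    unfolding H_def by (rule holomorphic_slice_coord[OF f quat_i_imag_unit])
  define F where "F = (\<lambda>l z. (H l z + cnj (H l (cnj z))) / 2)"
  have F: "sym (F l)" for l
    unfolding sym_def F_def using H holomorphic_reflection[OF H]
    by (auto intro!: holomorphic_intros)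
  have "f q = stem_ext F q" if "q \<in> \<Omega>" for q
  proof (rule slice_identity_principle[OF f stem_ext_regular[OF F] _ that])
    fix x assume x: "of_real x \<in> \<Omega>"
    have "Re (F l (of_real x)) = qcoord l (f (of_real x))" for l
      by (simp add: F_def H_def Re_slice_coord)
    then show "f (of_real x) = stem_ext F (of_real x)"
      using stem_ext_real[OF F x] by (simp add: quat_comb_qcoord)
  qed
  with F that show ?thesis by blast
qed

text \<open>At a real point f takes its value in every slice, and the slices of i and j already meet
  only in the reals. The three imaginary stem functions therefore vanish on the real axis, hence
  everywhere.\<close>

lemma slice_preserving_imp_ext:
  assumes f: "f \<in> slice_preserving \<Omega>"
  obtains G where "sym G" "\<And>q. q \<in> \<Omega> \<Longrightarrow> f q = slice_ext G q"
proof -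
  obtain F where F: "\<And>l. sym (F l)" "\<And>q. q \<in> \<Omega> \<Longrightarrow> f q = stem_ext F q"
    using stem_exists f unfolding slice_preserving_def by blast
  have F0: "F l z = 0" if "l \<noteq> Q0" "z \<in> D" for l z
  proof (rule real_identity[where G = "\<lambda>_. 0", OF sym_holomorphic[OF F(1)] _ _ that(2)])
    fix x assume x: "complex_of_real x \<in> D"
    then have x': "of_real x \<in> \<Omega>" by (simp add: of_real_mem_iff)
    have "of_real x \<in> slice_plane I" for I
      unfolding slice_plane_eq by (metis rangeI slice_embed_simps(3))
    then have *: "f (of_real x) \<in> slice_plane I" if "I \<in> imag_units" for I
      using f x' that unfolding slice_preserving_def by blast
    have "quat_j \<in> imag_units" by (simp add: imag_units_iff)
    then obtain z w where "f (of_real x) = slice_embed quat_i z" "f (of_real x) = slice_embed quat_j w"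
      using *[OF quat_i_imag_unit] *[of quat_j] unfolding slice_plane_eq by blast
    then have "qIm2 (f (of_real x)) = 0" "qIm3 (f (of_real x)) = 0" "qIm1 (f (of_real x)) = 0"
      by (simp_all add: quat_eq_iff slice_embed_scaleR)
    then have "qcoord l (f (of_real x)) = 0" using that by (cases l) simp_all
    then have "Re (F l (of_real x)) = 0"
      using F(2)[OF x'] qcoord_stem_ext_real[OF F(1) x', of l] by simp
    then show "F l (of_real x) = 0"
      using sym_real[OF F(1) x] by (simp add: complex_is_Real_iff complex_eq_iff)
  qed simp
  have "f q = slice_ext (F Q0) q" if "q \<in> \<Omega>" for q
  proof -
    obtain J z where "J \<in> imag_units" "z \<in> D" "q = slice_embed J z"
      using slice_embed_cases[OF \<open>q \<in> \<Omega>\<close>] .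
    then show ?thesis
      using F(2)[OF that] F0 by (simp add: stem_ext_embed[OF F(1)] slice_ext_embed[OF F(1)] quat_comb_def)
  qed
  with F(1) that show ?thesis by blast
qed

end

subsection \<open>Star products of stem functions\<close>

lemma imag_units_norm_iff: "J \<in> imag_units \<longleftrightarrow> qRe J = 0 \<and> norm J = 1"
  by (auto simp: imag_units_iff norm_quat_def)

lemma quat_mult_cnj: "q * quat_cnj q = of_real ((norm q)\<^sup>2)"
  by (simp add: quat_eq_iff quat_cnj_def norm_quat_def power2_eq_square)

lemma quat_sphere_eq: "quat_sphere \<alpha> \<beta> = {slice_embed J (Complex \<alpha> \<beta>) | J. J \<in> imag_units}"
  by (simp add: quat_sphere_def slice_embed_def)

definition stem_mult :: "(qidx \<Rightarrow> complex \<Rightarrow> complex) \<Rightarrow> (qidx \<Rightarrow> complex \<Rightarrow> complex) \<Rightarrow> qidx \<Rightarrow> complex \<Rightarrow> complex" where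
  "stem_mult F G l z = (case l of
      Q0 \<Rightarrow> F Q0 z * G Q0 z - F Q1 z * G Q1 z - F Q2 z * G Q2 z - F Q3 z * G Q3 z
    | Q1 \<Rightarrow> F Q0 z * G Q1 z + G Q0 z * F Q1 z + (F Q2 z * G Q3 z - F Q3 z * G Q2 z)
    | Q2 \<Rightarrow> F Q0 z * G Q2 z + G Q0 z * F Q2 z + (F Q3 z * G Q1 z - F Q1 z * G Q3 z)
    | Q3 \<Rightarrow> F Q0 z * G Q3 z + G Q0 z * F Q3 z + (F Q1 z * G Q2 z - F Q2 z * G Q1 z))"

lemma stem_mult_simps [simp]:
  "stem_mult F G Q0 z = F Q0 z * G Q0 z - F Q1 z * G Q1 z - F Q2 z * G Q2 z - F Q3 z * G Q3 z"
  "stem_mult F G Q1 z = F Q0 z * G Q1 z + G Q0 z * F Q1 z + (F Q2 z * G Q3 z - F Q3 z * G Q2 z)"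
  "stem_mult F G Q2 z = F Q0 z * G Q2 z + G Q0 z * F Q2 z + (F Q3 z * G Q1 z - F Q1 z * G Q3 z)"
  "stem_mult F G Q3 z = F Q0 z * G Q3 z + G Q0 z * F Q3 z + (F Q1 z * G Q2 z - F Q2 z * G Q1 z)"
  by (simp_all add: stem_mult_def)

definition stem_norm :: "(qidx \<Rightarrow> complex \<Rightarrow> complex) \<Rightarrow> complex \<Rightarrow> complex" where
  "stem_norm F z = (F Q0 z)\<^sup>2 + (F Q1 z)\<^sup>2 + (F Q2 z)\<^sup>2 + (F Q3 z)\<^sup>2"

text \<open>Euler's four-square identity, with complex entries.\<close>

lemma stem_norm_stem_mult: "stem_norm (stem_mult F G) z = stem_norm F z * stem_norm G z"
  by (simp add: stem_norm_def power2_eq_square algebra_simps)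

lemma stem_norm_scale: "(\<And>l. F l z = c * G l z) \<Longrightarrow> stem_norm F z = c\<^sup>2 * stem_norm G z"
  by (simp add: stem_norm_def algebra_simps)

text \<open>A complexified quaternion is written as A plus the central imaginary unit times B, with
  quaternions A and B given by \<open>rpart\<close> and \<open>ipart\<close>. On the slice of J its
  value is A + J * B.\<close>

definition rpart :: "(qidx \<Rightarrow> complex \<Rightarrow> complex) \<Rightarrow> complex \<Rightarrow> quat" where
  "rpart F z = quat_comb (\<lambda>l. of_real (Re (F l z)))"

definition ipart :: "(qidx \<Rightarrow> complex \<Rightarrow> complex) \<Rightarrow> complex \<Rightarrow> quat" where
  "ipart F z = quat_comb (\<lambda>l. of_real (Im (F l z)))"

lemma quat_comb_parts: "quat_comb (\<lambda>l. slice_embed J (F l z)) = rpart F z + J * ipart F z"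
  unfolding quat_comb_slice_embed rpart_def ipart_def ..

lemma parts_stem_mult:
  "rpart (stem_mult F G) z = rpart F z * rpart G z - ipart F z * ipart G z"
  "ipart (stem_mult F G) z = rpart F z * ipart G z + ipart F z * rpart G z"
  by (simp_all add: rpart_def ipart_def quat_comb_of_real quat_eq_iff algebra_simps)

lemma parts_zero_iff: "rpart F z = 0 \<and> ipart F z = 0 \<longleftrightarrow> (\<forall>l. F l z = 0)"
  unfolding qidx_all by (auto simp: rpart_def ipart_def quat_comb_of_real quat_eq_iff complex_eq_iff)

lemma stem_norm_parts:
  "Re (stem_norm F z) = (norm (rpart F z))\<^sup>2 - (norm (ipart F z))\<^sup>2"
  "Im (stem_norm F z) = 2 * qRe (rpart F z * quat_cnj (ipart F z))"
  by (simp_all add: stem_norm_def rpart_def ipart_def quat_comb_of_real norm_quat_def quat_cnj_def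
      Re_power2 Im_power2 algebra_simps)

text \<open>Vanishing of the norm means that A and B have equal modulus and that A times the
  conjugate of B has no real part. This is just what makes - A / B an imaginary unit; if B = 0 then
  A = 0 and any unit will do.\<close>

lemma stem_norm_zero_imp_root:
  assumes "stem_norm F z = 0"
  obtains J where "J \<in> imag_units" "quat_comb (\<lambda>l. slice_embed J (F l z)) = 0"
proof -
  define A B where "A = rpart F z" and "B = ipart F z"
  have norm: "norm A = norm B" and re: "qRe (A * quat_cnj B) = 0"
    using stem_norm_parts[of F z] assms by (simp_all add: A_def B_def)
  show ?thesis
  proof (cases "B = 0")
    case True
    then show ?thesis using that[of quat_i] norm by (simp add: quat_comb_parts A_def B_def)
  next
    case False
    define J where "J = - (A * inverse B)"
    have "norm J = 1" using norm False by (simp add: J_def norm_mult norm_inverse)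
    moreover have "J = - (inverse ((norm B)\<^sup>2) *\<^sub>R (A * quat_cnj B))"
      by (simp add: J_def inverse_quat_def)
    then have "qRe J = 0" using re by (simp del: quat_mult_simps)
    ultimately have "J \<in> imag_units" by (simp add: imag_units_norm_iff)
    moreover have "A + J * B = 0" using False by (simp add: J_def mult.assoc)
    ultimately show ?thesis using that by (simp add: quat_comb_parts A_def B_def)
  qed
qed

lemma root_imp_stem_norm_zero:
  assumes J: "J \<in> imag_units" and "quat_comb (\<lambda>l. slice_embed J (F l z)) = 0"
  shows "stem_norm F z = 0"
proof -
  define A B where "A = rpart F z" and "B = ipart F z"
  have "A + J * B = 0" using assms(2) by (simp add: quat_comb_parts A_def B_def)
  then have A: "A = - (J * B)" by (simp add: eq_neg_iff_add_eq_0)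
  then have "norm A = norm B" using imag_unit_norm[OF J] by (simp add: norm_mult)
  moreover have "A * quat_cnj B = - ((norm B)\<^sup>2 *\<^sub>R J)"
    unfolding A by (simp add: mult.assoc quat_mult_cnj) (simp add: of_real_def)
  then have "qRe (A * quat_cnj B) = 0" using J by (simp add: imag_units_iff)
  ultimately show ?thesis
    using stem_norm_parts[of F z] by (simp add: complex_eq_iff A_def B_def)
qed

text \<open>The two units i and -i suffice: A + i * B = 0 and A - i * B = 0 give A = B = 0.\<close>

lemma all_roots_imp_zero:
  fixes F :: "qidx \<Rightarrow> complex \<Rightarrow> complex"
  assumes "\<And>J. J \<in> imag_units \<Longrightarrow> quat_comb (\<lambda>l. slice_embed J (F l z)) = 0"
  shows "F l z = 0"
proof -
  have "rpart F z + quat_i * ipart F z = 0" "rpart F z + (- quat_i) * ipart F z = 0"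
    using assms[of quat_i] assms[of "- quat_i"] imag_units_uminus[OF quat_i_imag_unit]
    by (simp_all add: quat_comb_parts)
  moreover have "a = 0 \<and> b = 0" if "a + quat_i * b = 0" "a + (- quat_i) * b = 0" for a b
    using that by (simp add: quat_eq_iff)
  ultimately have "rpart F z = 0 \<and> ipart F z = 0" by blast
  then show ?thesis unfolding parts_zero_iff by blast
qed

text \<open>The stem functions of the linear factor q - p.\<close>

definition linear_stem :: "quat \<Rightarrow> qidx \<Rightarrow> complex \<Rightarrow> complex" where
  "linear_stem p l z = (if l = Q0 then z else 0) - of_real (qcoord l p)"

text \<open>Quaternionic conjugation extended complex linearly, so that the product of F with its
  conjugate is the scalar \<open>stem_norm F\<close>.\<close>

definition stem_cnj :: "(qidx \<Rightarrow> complex \<Rightarrow> complex) \<Rightarrow> qidx \<Rightarrow> complex \<Rightarrow> complex" where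
  "stem_cnj F l z = (if l = Q0 then F l z else - F l z)"

lemma stem_mult_stem_cnj: "stem_mult F (stem_mult (stem_cnj F) G) l z = stem_norm F z * G l z"
  by (cases l) (simp_all add: stem_cnj_def stem_norm_def power2_eq_square algebra_simps)

context slice_domain
begin

lemma sym_stem_mult:
  assumes "\<And>l. sym (F l)" "\<And>l. sym (G l)"
  shows "sym (stem_mult F G l)"
  unfolding stem_mult_def[abs_def] by (cases l) (auto intro!: sym_intros assms)

lemma sym_stem_norm: "(\<And>l. sym (F l)) \<Longrightarrow> sym (stem_norm F)"
  unfolding stem_norm_def[abs_def] by (intro sym_intros)

lemma sym_linear_stem: "sym (linear_stem p l)"
  unfolding linear_stem_def[abs_def] by (cases l) (auto intro!: sym_intros)

lemma sym_stem_cnj: "(\<And>l. sym (F l)) \<Longrightarrow> sym (stem_cnj F l)"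
  unfolding stem_cnj_def[abs_def] by (cases l) (auto intro!: sym_intros)

lemma stem_ext_linear_stem:
  assumes "q \<in> \<Omega>"
  shows "stem_ext (linear_stem p) q = q - p"
proof -
  obtain J z where Jz: "J \<in> imag_units" "z \<in> D" "q = slice_embed J z"
    using slice_embed_cases[OF assms] .
  have "stem_ext (linear_stem p) q = quat_comb (\<lambda>l. slice_embed J (linear_stem p l z))"
    using stem_ext_embed[OF sym_linear_stem Jz(1,2)] Jz(3) by simp
  also have "\<dots> = slice_embed J z - quat_comb (\<lambda>l. of_real (qcoord l p))"
    by (simp add: quat_comb_def linear_stem_def slice_embed_diff slice_embed_minus algebra_simps)
  finally show ?thesis by (simp add: quat_comb_qcoord Jz(3))
qed

lemma stem_ext_cong:
  assumes "\<And>l. sym (F l)" "\<And>l. sym (G l)" "\<And>l z. z \<in> D \<Longrightarrow> F l z = G l z" "q \<in> \<Omega>"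
  shows "stem_ext F q = stem_ext G q"
proof -
  obtain J z where Jz: "J \<in> imag_units" "z \<in> D" "q = slice_embed J z"
    using slice_embed_cases[OF assms(4)] .
  then show ?thesis using assms(1-3) by (simp add: stem_ext_embed)
qed

text \<open>The decomposition is an arbitrary choice, but its components have stem functions of
  their own, and \<open>stem_unique\<close> identifies these with F.\<close>

lemma slice_decomposition_ext:
  assumes F: "\<And>l. sym (F l)" and f: "\<And>q. q \<in> \<Omega> \<Longrightarrow> f q = stem_ext F q"
    and dec: "slice_decomposition \<Omega> f = (f0, f1, f2, f3)"
    and J: "J \<in> imag_units" and z: "z \<in> D"
  shows "f0 (slice_embed J z) = slice_embed J (F Q0 z)" "f1 (slice_embed J z) = slice_embed J (F Q1 z)"
    "f2 (slice_embed J z) = slice_embed J (F Q2 z)" "f3 (slice_embed J z) = slice_embed J (F Q3 z)"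
proof -
  have "is_slice_decomposition \<Omega> f (slice_ext (F Q0), slice_ext (F Q1), slice_ext (F Q2), slice_ext (F Q3))"
    unfolding is_slice_decomposition_def
    using f slice_ext_preserving[OF F] by (auto simp: stem_ext_def quat_comb_def)
  then have "is_slice_decomposition \<Omega> f (slice_decomposition \<Omega> f)"
    unfolding slice_decomposition_def by (rule someI)
  then have pres: "{f0, f1, f2, f3} \<subseteq> slice_preserving \<Omega>"
    and f': "\<And>q. q \<in> \<Omega> \<Longrightarrow> f q = f0 q + f1 q * quat_i + f2 q * quat_j + f3 q * quat_k"
    unfolding dec is_slice_decomposition_def by auto
  obtain G0 where G0: "sym G0" "\<And>q. q \<in> \<Omega> \<Longrightarrow> f0 q = slice_ext G0 q"
    using slice_preserving_imp_ext pres by blast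
  obtain G1 where G1: "sym G1" "\<And>q. q \<in> \<Omega> \<Longrightarrow> f1 q = slice_ext G1 q"
    using slice_preserving_imp_ext pres by blast
  obtain G2 where G2: "sym G2" "\<And>q. q \<in> \<Omega> \<Longrightarrow> f2 q = slice_ext G2 q"
    using slice_preserving_imp_ext pres by blast
  obtain G3 where G3: "sym G3" "\<And>q. q \<in> \<Omega> \<Longrightarrow> f3 q = slice_ext G3 q"
    using slice_preserving_imp_ext pres by blast
  define G where "G = case_qidx G0 G1 G2 G3"
  have G: "sym (G l)" for l using G0 G1 G2 G3 by (cases l) (simp_all add: G_def)
  have "stem_ext F q = stem_ext G q" if "q \<in> \<Omega>" for q
    using f[OF that] f'[OF that] G0(2)[OF that] G1(2)[OF that] G2(2)[OF that] G3(2)[OF that]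
    by (simp add: stem_ext_def quat_comb_def G_def)
  then have FG: "F l z = G l z" for l using stem_unique[where F = F and G = G, OF F G _ z] by blast
  have q: "slice_embed J z \<in> \<Omega>" using J z slice_embed_mem_iff by blast
  show "f0 (slice_embed J z) = slice_embed J (F Q0 z)" "f1 (slice_embed J z) = slice_embed J (F Q1 z)"
    "f2 (slice_embed J z) = slice_embed J (F Q2 z)" "f3 (slice_embed J z) = slice_embed J (F Q3 z)"
    using G0 G1 G2 G3 by (simp_all add: FG G_def q slice_ext_embed J z)
qed

lemma star_stem_ext:
  assumes F: "\<And>l. sym (F l)" "\<And>q. q \<in> \<Omega> \<Longrightarrow> f q = stem_ext F q"
    and G: "\<And>l. sym (G l)" "\<And>q. q \<in> \<Omega> \<Longrightarrow> g q = stem_ext G q"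
    and q: "q \<in> \<Omega>"
  shows "star \<Omega> f g q = stem_ext (stem_mult F G) q"
proof -
  obtain J z where Jz: "J \<in> imag_units" "z \<in> D" "q = slice_embed J z"
    using slice_embed_cases[OF q] .
  obtain f0 f1 f2 f3 where f: "slice_decomposition \<Omega> f = (f0, f1, f2, f3)" by (metis prod_cases4)
  obtain g0 g1 g2 g3 where g: "slice_decomposition \<Omega> g = (g0, g1, g2, g3)" by (metis prod_cases4)
  note fq = slice_decomposition_ext[OF F f Jz(1,2), folded Jz(3)]
  note gq = slice_decomposition_ext[OF G g Jz(1,2), folded Jz(3)]
  have "stem_ext (stem_mult F G) q = quat_comb (\<lambda>l. slice_embed J (stem_mult F G l z))"
    using stem_ext_embed[OF sym_stem_mult[OF F(1) G(1)] Jz(1,2)] Jz(3) by simp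
  \<comment> \<open>Both values lie in the slice of J and commute, which settles the order of the
    factors taken from F and G.\<close>
  moreover have "slice_embed J (G Q0 z) * (slice_embed J (F l z) * x)
      = slice_embed J (F l z) * (slice_embed J (G Q0 z) * x)" for l x
    using slice_embed_commute[OF Jz(1), of "G Q0 z" "F l z"] by (simp flip: mult.assoc)
  ultimately show ?thesis
    by (simp add: star_def f g fq gq quat_comb_def slice_embed_add slice_embed_diff
        slice_embed_mult[OF Jz(1)] algebra_simps)
qed

section \<open>Splitting off linear star factors\<close>

lemma root_poly_nonreal:
  "Im z0 \<noteq> 0 \<Longrightarrow> root_poly z0 w = (w - of_real (Re z0))\<^sup>2 + of_real ((Im z0)\<^sup>2)"
  by (simp add: root_poly_def complex_eq_iff power2_eq_square algebra_simps)

text \<open>The squared imaginary coordinates of a point on the sphere add up to the squared radius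
  for every unit J, so the norm of q - p depends only on the sphere of p.\<close>

lemma stem_norm_linear_stem:
  assumes "J \<in> imag_units" "Im z0 \<noteq> 0"
  shows "stem_norm (linear_stem (slice_embed J z0)) w = root_poly z0 w"
proof -
  have "(Im z0 * qIm1 J)\<^sup>2 + (Im z0 * qIm2 J)\<^sup>2 + (Im z0 * qIm3 J)\<^sup>2
      = (Im z0)\<^sup>2 * ((qIm1 J)\<^sup>2 + (qIm2 J)\<^sup>2 + (qIm3 J)\<^sup>2)"
    by (simp add: algebra_simps power_mult_distrib)
  also have "\<dots> = (Im z0)\<^sup>2" using assms(1) by (simp add: imag_units_iff)
  finally have "complex_of_real ((Im z0 * qIm1 J)\<^sup>2 + (Im z0 * qIm2 J)\<^sup>2 + (Im z0 * qIm3 J)\<^sup>2)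
      = of_real ((Im z0)\<^sup>2)" by (rule arg_cong)
  moreover have "stem_norm (linear_stem (slice_embed J z0)) w = (w - of_real (Re z0))\<^sup>2
      + of_real ((Im z0 * qIm1 J)\<^sup>2 + (Im z0 * qIm2 J)\<^sup>2 + (Im z0 * qIm3 J)\<^sup>2)"
    using assms(1) by (simp add: stem_norm_def linear_stem_def slice_embed_scaleR imag_units_iff)
  ultimately show ?thesis using root_poly_nonreal[OF assms(2)] by simp
qed

lemma parts_linear_stem:
  assumes "J \<in> imag_units"
  shows "rpart (linear_stem (slice_embed J z)) z = - (Im z *\<^sub>R J)" "ipart (linear_stem (slice_embed J z)) z = of_real (Im z)"
    "rpart (stem_cnj (linear_stem (slice_embed J z))) z = Im z *\<^sub>R J"
    "ipart (stem_cnj (linear_stem (slice_embed J z))) z = of_real (Im z)"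
  unfolding rpart_def ipart_def quat_comb_of_real using assms
  by (simp_all add: linear_stem_def stem_cnj_def slice_embed_scaleR imag_units_iff quat_eq_iff)

text \<open>With P the stem of q - p, the quotient of G by P must be the conjugate of P times G,
  divided by the norm of P, which is \<open>root_poly z0\<close>. The relation A = - J * B at z0
  makes the numerator vanish there in all components, and symmetry makes it divisible by the whole
  polynomial. Multiplying back by P recovers G.\<close>

lemma split_linear_factor:
  assumes G: "\<And>l. sym (G l)" and z0: "z0 \<in> D" "Im z0 \<noteq> 0" "stem_norm G z0 = 0"
  shows "\<exists>J H. J \<in> imag_units \<and> quat_comb (\<lambda>l. slice_embed J (G l z0)) = 0 \<and> (\<forall>l. sym (H l)) \<and>
    (\<forall>l. \<forall>w\<in>D. G l w = stem_mult (linear_stem (slice_embed J z0)) H l w)"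
proof -
  obtain J where J: "J \<in> imag_units" "quat_comb (\<lambda>l. slice_embed J (G l z0)) = 0"
    using stem_norm_zero_imp_root[OF z0(3)] .
  define P where "P = linear_stem (slice_embed J z0)"
  have symP: "sym (P l)" for l unfolding P_def by (rule sym_linear_stem)
  define A B where "A = rpart G z0" and "B = ipart G z0"
  have A: "A = - (J * B)"
    using J(2) by (simp add: quat_comb_parts A_def B_def eq_neg_iff_add_eq_0)
  have "rpart (stem_mult (stem_cnj P) G) z0 = 0 \<and> ipart (stem_mult (stem_cnj P) G) z0 = 0"
    unfolding parts_stem_mult P_def parts_linear_stem[OF J(1)] A_def[symmetric] B_def[symmetric] A
    by (simp add: imag_unit_square_left[OF J(1)] of_real_def)
  then have "stem_mult (stem_cnj P) G l z0 = 0" for l unfolding parts_zero_iff by blast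
  moreover have "sym (stem_mult (stem_cnj P) G l)" for l
    by (intro sym_stem_mult sym_stem_cnj symP G)
  ultimately have "\<exists>H. sym H \<and> (\<forall>w\<in>D. stem_mult (stem_cnj P) G l w = root_poly z0 w * H w)" for l
    using sym_divide_root[OF _ _ z0(1)] by blast
  then obtain H where H: "\<And>l. sym (H l)"
      "\<And>l w. w \<in> D \<Longrightarrow> stem_mult (stem_cnj P) G l w = root_poly z0 w * H l w"
    by metis
  obtain z1 where z1: "z1 \<in> D" "root_poly z0 z1 \<noteq> 0" using root_poly_nonzero[OF z0(1)] .
  have "G l w = stem_mult P H l w" if "w \<in> D" for l w
  proof (rule holomorphic_mult_left_cancel[OF open_D connected_D sym_holomorphic[OF sym_root_poly]
        sym_holomorphic[OF G] sym_holomorphic[OF sym_stem_mult[OF symP H(1)]] z1 _ that])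
    fix w assume w: "w \<in> D"
    have "root_poly z0 w * G l w = stem_mult P (stem_mult (stem_cnj P) G) l w"
      unfolding stem_mult_stem_cnj by (simp add: P_def stem_norm_linear_stem[OF J(1) z0(2)])
    also have "\<dots> = root_poly z0 w * stem_mult P H l w"
      by (cases l) (simp_all only: stem_mult_simps(1-4)[of P] H(2)[OF w] algebra_simps)
    finally show "root_poly z0 w * G l w = root_poly z0 w * stem_mult P H l w" .
  qed
  with J H(1) show ?thesis unfolding P_def by blast
qed

text \<open>Each split lowers the exponent of \<open>root_poly z0\<close> in the norm by one; once
  the norm is nonzero at z0 no zero is left on the sphere. If p were the conjugate of the next root,
  the product of q - p with the remaining function would vanish at z0 in all components, against the
  assumption on G. The last conjunct, that G vanishes at the first root, feeds this argument in the
  induction.\<close>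

lemma star_factorization:
  assumes "\<And>l. sym (G l)" "z0 \<in> D" "Im z0 \<noteq> 0" "\<exists>l. G l z0 \<noteq> 0"
    and "K holomorphic_on D" "K z0 \<noteq> 0" "\<And>w. w \<in> D \<Longrightarrow> stem_norm G w = root_poly z0 w ^ n * K w"
  shows "\<exists>ps g. length ps = n \<and> set ps \<subseteq> quat_sphere (Re z0) (Im z0) \<and>
     (\<forall>\<nu>. Suc \<nu> < length ps \<longrightarrow> ps ! \<nu> \<noteq> quat_cnj (ps ! Suc \<nu>)) \<and>
     g \<in> slice_regular \<Omega> \<and> (\<forall>q\<in>quat_sphere (Re z0) (Im z0). g q \<noteq> 0) \<and>
     (\<forall>q\<in>\<Omega>. stem_ext G q = foldr (\<lambda>p. star \<Omega> (\<lambda>q. q - p)) ps g q) \<and>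
     (ps \<noteq> [] \<longrightarrow> stem_ext G (hd ps) = 0)"
  using assms
proof (induction n arbitrary: G)
  case 0
  have "stem_ext G q \<noteq> 0" if "q \<in> quat_sphere (Re z0) (Im z0)" for q
  proof
    assume "stem_ext G q = 0"
    moreover obtain J where J: "J \<in> imag_units" "q = slice_embed J z0"
      using \<open>q \<in> quat_sphere (Re z0) (Im z0)\<close> by (auto simp: quat_sphere_eq)
    ultimately have "stem_norm G z0 = 0"
      using root_imp_stem_norm_zero[OF J(1), of G z0] stem_ext_embed[OF 0(1) J(1) 0(2)] by simp
    then show False using 0(6) 0(7)[OF 0(2)] by simp
  qed
  then show ?case
    using stem_ext_regular[OF 0(1)] by (intro exI[of _ "[]"] exI[of _ "stem_ext G"]) simp
next
  case (Suc n)
  have "stem_norm G z0 = 0" using Suc.prems(7)[OF Suc.prems(2)] by simp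
  then obtain J H where J: "J \<in> imag_units" "quat_comb (\<lambda>l. slice_embed J (G l z0)) = 0"
    and H: "\<And>l. sym (H l)" "\<And>l w. w \<in> D \<Longrightarrow> G l w = stem_mult (linear_stem (slice_embed J z0)) H l w"
    using split_linear_factor[where G = G, OF Suc.prems(1-3)] by blast
  define p where "p = slice_embed J z0"
  obtain z1 where z1: "z1 \<in> D" "root_poly z0 z1 \<noteq> 0" using root_poly_nonzero[OF Suc.prems(2)] .
  have rp: "root_poly z0 holomorphic_on D" by (rule sym_holomorphic[OF sym_root_poly])
  have nrmH: "stem_norm H w = root_poly z0 w ^ n * K w" if "w \<in> D" for w
  proof (rule holomorphic_mult_left_cancel[OF open_D connected_D rp
        sym_holomorphic[OF sym_stem_norm[OF H(1)]] _ z1 _ that])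
    show "(\<lambda>w. root_poly z0 w ^ n * K w) holomorphic_on D"
      by (intro holomorphic_intros rp Suc.prems)
    fix w assume w: "w \<in> D"
    have "stem_norm G w = stem_norm (stem_mult (linear_stem p) H) w"
      unfolding stem_norm_def p_def using H(2)[OF w] by simp
    also have "\<dots> = root_poly z0 w * stem_norm H w"
      by (simp add: stem_norm_stem_mult p_def stem_norm_linear_stem[OF J(1) Suc.prems(3)])
    finally show "root_poly z0 w * stem_norm H w = root_poly z0 w * (root_poly z0 w ^ n * K w)"
      using Suc.prems(7)[OF w] by (simp only: power_Suc mult.assoc)
  qed
  have "\<exists>l. H l z0 \<noteq> 0"
  proof (rule ccontr)
    assume "\<not> ?thesis"
    then have "stem_mult (linear_stem p) H l z0 = 0" for l by (cases l) simp_all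
    then show False using Suc.prems(2,4) H(2) p_def by metis
  qed
  from Suc.IH[of H, OF H(1) Suc.prems(2,3) this Suc.prems(5,6) nrmH]
  obtain ps g where len: "length ps = n" and sph: "set ps \<subseteq> quat_sphere (Re z0) (Im z0)"
    and ncnj: "\<forall>\<nu>. Suc \<nu> < length ps \<longrightarrow> ps ! \<nu> \<noteq> quat_cnj (ps ! Suc \<nu>)"
    and g: "g \<in> slice_regular \<Omega>" "\<forall>q\<in>quat_sphere (Re z0) (Im z0). g q \<noteq> 0"
    and eq: "\<forall>q\<in>\<Omega>. stem_ext H q = foldr (\<lambda>p. star \<Omega> (\<lambda>q. q - p)) ps g q"
    and hd: "ps \<noteq> [] \<longrightarrow> stem_ext H (hd ps) = 0"
    by blast
  have p_hd: "p \<noteq> quat_cnj (hd ps)" if "ps \<noteq> []"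
  proof
    assume p: "p = quat_cnj (hd ps)"
    have "hd ps \<in> quat_sphere (Re z0) (Im z0)" using that sph by auto
    then obtain J' where J': "J' \<in> imag_units" "hd ps = slice_embed J' z0"
      by (auto simp: quat_sphere_eq)
    have "Im z0 *\<^sub>R J = Im z0 *\<^sub>R (- J')"
      using p J'(1) J(1)
      by (simp add: p_def J'(2) quat_eq_iff quat_cnj_def slice_embed_scaleR imag_units_iff)
    then have "J = - J'" using Suc.prems(3) by (simp only: scaleR_cancel_left) simp
    then have "J' = - J" by simp
    then have "rpart H z0 + (- J) * ipart H z0 = 0"
      using hd that stem_ext_embed[where F = H, OF H(1) J'(1) Suc.prems(2)] by (simp add: J'(2) quat_comb_parts)
    then have "rpart H z0 = J * ipart H z0" by simp
    then have "rpart (stem_mult (linear_stem p) H) z0 = 0 \<and> ipart (stem_mult (linear_stem p) H) z0 = 0"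
      unfolding parts_stem_mult p_def parts_linear_stem[OF J(1)]
      by (simp add: imag_unit_square_left[OF J(1)] of_real_def)
    then have "\<forall>l. stem_mult (linear_stem p) H l z0 = 0" unfolding parts_zero_iff .
    then show False using Suc.prems(2,4) H(2) p_def by metis
  qed
  have "stem_ext G q = star \<Omega> (\<lambda>q. q - p) (foldr (\<lambda>p. star \<Omega> (\<lambda>q. q - p)) ps g) q" if "q \<in> \<Omega>" for q
  proof -
    have "stem_ext G q = stem_ext (stem_mult (linear_stem p) H) q"
      by (rule stem_ext_cong[OF Suc.prems(1) sym_stem_mult[OF sym_linear_stem H(1)] _ that]) (simp only: H(2) p_def)
    also have "\<dots> = star \<Omega> (\<lambda>q. q - p) (foldr (\<lambda>p. star \<Omega> (\<lambda>q. q - p)) ps g) q"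
      by (rule star_stem_ext[OF sym_linear_stem _ H(1) _ that, symmetric]) (use eq stem_ext_linear_stem in auto)
    finally show ?thesis .
  qed
  moreover have "stem_ext G p = 0"
    unfolding p_def using stem_ext_embed[where F = G, OF Suc.prems(1) J(1) Suc.prems(2)] J(2) by simp
  moreover have "p \<in> quat_sphere (Re z0) (Im z0)"
    using J(1) by (auto simp: p_def quat_sphere_eq)
  moreover have "(p # ps) ! \<nu> \<noteq> quat_cnj ((p # ps) ! Suc \<nu>)" if "Suc \<nu> < length (p # ps)" for \<nu>
    using that ncnj p_hd by (cases \<nu>) (auto simp: hd_conv_nth)
  ultimately show ?case
    using len sph g by (intro exI[of _ "p # ps"] exI[of _ g]) auto
qed

end

subsection \<open>The order of the common zeros\<close>

lemma slice_embed_real_iff: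
  assumes "J \<in> imag_units"
  shows "slice_embed J z \<in> \<real> \<longleftrightarrow> z \<in> \<real>"
proof
  assume "slice_embed J z \<in> \<real>"
  then obtain x where "slice_embed J z = slice_embed J (of_real x)"
    by (auto elim!: Reals_cases)
  then have "slice_embed J (z - of_real x) = 0" by (simp add: slice_embed_diff)
  then show "z \<in> \<real>" using slice_embed_eq_0_iff[OF assms] by simp
qed (auto elim!: Reals_cases)

context slice_domain
begin

lemma stem_norm_real_zero:
  assumes F: "\<And>l. sym (F l)" and x: "complex_of_real x \<in> D" and "stem_norm F (of_real x) = 0"
  shows "F l (of_real x) = 0"
proof -
  define r where "r = (\<lambda>l. Re (F l (of_real x)))"
  have r: "F l (of_real x) = of_real (r l)" for l
    using sym_real[OF F x, of l] by (simp add: r_def)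
  have "complex_of_real ((r Q0)\<^sup>2 + (r Q1)\<^sup>2 + (r Q2)\<^sup>2 + (r Q3)\<^sup>2) = 0"
    using assms(3) by (simp add: stem_norm_def r)
  then have "(r Q0)\<^sup>2 + (r Q1)\<^sup>2 + (r Q2)\<^sup>2 + (r Q3)\<^sup>2 = 0"
    by (simp only: of_real_eq_0_iff)
  then have "\<forall>l. r l = 0" unfolding qidx_all by (simp add: add_nonneg_eq_0_iff)
  then show ?thesis by (simp add: r)
qed

text \<open>At nonreal points the norm may vanish although F does not, so the argument goes through
  the real axis: there a zero norm annihilates F, and \<open>real_identity\<close> spreads this over
  D.\<close>

lemma stem_norm_not_identically_zero:
  assumes F: "\<And>l. sym (F l)" and "z \<in> D" "F l z \<noteq> 0"
  obtains z1 where "z1 \<in> D" "stem_norm F z1 \<noteq> 0"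
proof (rule ccontr)
  assume "\<not> thesis"
  with that have "stem_norm F w = 0" if "w \<in> D" for w using \<open>w \<in> D\<close> by blast
  then have "F l z = 0"
    by (intro real_identity[OF sym_holomorphic[OF F] holomorphic_on_const _ \<open>z \<in> D\<close>] stem_norm_real_zero[of F] F)
      auto
  with assms(3) show False by simp
qed

lemma stem_ext_scale:
  assumes F: "\<And>l. sym (F l)" and G: "\<And>l. sym (G l)"
    and eq: "\<And>l. F l z = c * G l z" and Jz: "J \<in> imag_units" "z \<in> D"
  shows "stem_ext F (slice_embed J z) = slice_embed J c * stem_ext G (slice_embed J z)"
  using Jz by (simp add: stem_ext_embed F G eq slice_embed_mult quat_comb_mult_left)

lemma slice_embed_root_poly:
  assumes "J \<in> imag_units" "Im z0 \<noteq> 0"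
  shows "slice_embed J (root_poly z0 z)
    = (slice_embed J z - of_real (Re z0))\<^sup>2 + of_real ((Im z0)\<^sup>2)"
  unfolding root_poly_nonreal[OF assms(2)]
  by (simp only: slice_embed_add slice_embed_power[OF assms(1)] slice_embed_diff slice_embed_simps)

lemma sphere_subset: "Complex \<alpha> \<beta> \<in> D \<Longrightarrow> quat_sphere \<alpha> \<beta> \<subseteq> \<Omega>"
  using slice_embed_mem_iff by (auto simp: quat_sphere_eq)

lemma sphere_factorizationI:
  assumes F: "\<And>l. sym (F l)" "\<And>q. q \<in> \<Omega> \<Longrightarrow> f q = stem_ext F q"
    and G: "\<And>l. sym (G l)" "\<And>l w. w \<in> D \<Longrightarrow> F l w = root_poly z0 w ^ k * G l w"
    and z0: "z0 \<in> D" "Im z0 \<noteq> 0"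
    and ps: "set ps \<subseteq> quat_sphere (Re z0) (Im z0)"
      "\<forall>\<nu>. Suc \<nu> < length ps \<longrightarrow> ps ! \<nu> \<noteq> quat_cnj (ps ! Suc \<nu>)"
    and g: "g \<in> slice_regular \<Omega>" "\<forall>q\<in>quat_sphere (Re z0) (Im z0). g q \<noteq> 0"
      "\<forall>q\<in>\<Omega>. stem_ext G q = foldr (\<lambda>p. star \<Omega> (\<lambda>q. q - p)) ps g q"
  shows "sphere_factorization \<Omega> f (Re z0) (Im z0) k ps g"
  unfolding sphere_factorization_def
proof (intro conjI ballI)
  show "quat_sphere (Re z0) (Im z0) \<subseteq> \<Omega>" using z0 by (intro sphere_subset) simp
  fix q assume q: "q \<in> \<Omega>"
  obtain J z where Jz: "J \<in> imag_units" "z \<in> D" "q = slice_embed J z"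
    using slice_embed_cases[OF q] .
  have "f q = slice_embed J (root_poly z0 z ^ k) * stem_ext G q"
    unfolding F(2)[OF q] unfolding Jz(3) by (rule stem_ext_scale[OF F(1) G(1) G(2) Jz(1,2)]) (rule Jz)
  then show "f q = ((q - of_real (Re z0))\<^sup>2 + of_real ((Im z0)\<^sup>2)) ^ k *
      foldr (\<lambda>p. star \<Omega> (\<lambda>q. q - p)) ps g q"
    using g(3) q by (simp add: slice_embed_power[OF Jz(1)] slice_embed_root_poly[OF Jz(1) z0(2)] Jz(3))
qed (use z0 ps g in auto)

text \<open>Once the largest common power is removed, the exponent n of \<open>root_poly z0\<close>
  in the norm of G is the number of linear star factors of f on the sphere. A positive n would give
  the first root isolated multiplicity n.\<close>

lemma common_order:
  assumes F: "\<And>l. sym (F l)" "\<And>q. q \<in> \<Omega> \<Longrightarrow> f q = stem_ext F q"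
    and nz: "z1 \<in> D" "F l1 z1 \<noteq> 0"
    and iso: "no_nonreal_isolated_zeros \<Omega> f" and z0: "z0 \<in> D"
  shows "\<exists>k G. (\<forall>l. sym (G l)) \<and> (\<forall>l. \<forall>w\<in>D. F l w = root_poly z0 w ^ k * G l w) \<and> stem_norm G z0 \<noteq> 0"
proof -
  obtain k G l where G: "\<And>l. sym (G l)" "\<And>l w. w \<in> D \<Longrightarrow> F l w = root_poly z0 w ^ k * G l w"
      "G l z0 \<noteq> 0"
    using common_root_factor[of F, OF F(1) nz z0] by blast
  have "stem_norm G z0 \<noteq> 0"
  proof (cases "Im z0 = 0")
    case True
    then have "z0 = of_real (Re z0)" by (simp add: complex_eq_iff)
    then show ?thesis using stem_norm_real_zero[of G "Re z0" l] G(1,3) z0 by metis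
  next
    case False
    obtain z2 where z2: "z2 \<in> D" "stem_norm G z2 \<noteq> 0"
      using stem_norm_not_identically_zero[of G, OF G(1) z0 G(3)] .
    \<comment> \<open>With a one-element index type the lemma on common roots factors a single
      function.\<close>
    obtain n K where K: "sym K" "\<And>w. w \<in> D \<Longrightarrow> stem_norm G w = root_poly z0 w ^ n * K w" "K z0 \<noteq> 0"
      using common_root_factor[of "\<lambda>_::unit. stem_norm G", OF sym_stem_norm[of G, OF G(1)] z2 z0] by blast
    obtain ps g where len: "length ps = n" and sph: "set ps \<subseteq> quat_sphere (Re z0) (Im z0)"
      and ps: "\<forall>\<nu>. Suc \<nu> < length ps \<longrightarrow> ps ! \<nu> \<noteq> quat_cnj (ps ! Suc \<nu>)"
      "g \<in> slice_regular \<Omega>" "\<forall>q\<in>quat_sphere (Re z0) (Im z0). g q \<noteq> 0"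
      "\<forall>q\<in>\<Omega>. stem_ext G q = foldr (\<lambda>p. star \<Omega> (\<lambda>q. q - p)) ps g q"
      using star_factorization[of G, OF G(1) z0 False _ sym_holomorphic[OF K(1)] K(3,2)] G(3) by blast
    have fac: "sphere_factorization \<Omega> f (Re z0) (Im z0) k ps g"
      by (rule sphere_factorizationI[of F f G, OF F G(1,2) z0 False sph ps])
    have "n = 0"
    proof (rule ccontr)
      assume "n \<noteq> 0"
      then have "hd ps \<in> quat_sphere (Re z0) (Im z0)" using len sph by (cases ps) auto
      then obtain J where J: "J \<in> imag_units" "hd ps = slice_embed J z0"
        by (auto simp: quat_sphere_eq)
      then have "hd ps \<in> \<Omega> - \<real>"
        using slice_embed_mem_iff z0 False slice_embed_real_iff[OF J(1)] by (auto simp: complex_is_Real_iff)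
      moreover have "has_isolated_multiplicity \<Omega> f (hd ps) n"
        unfolding has_isolated_multiplicity_def using fac len \<open>n \<noteq> 0\<close> by blast
      ultimately show False using iso unfolding no_nonreal_isolated_zeros_def by blast
    qed
    then show ?thesis using K(2)[OF z0] K(3) by simp
  qed
  with G(1,2) show ?thesis by blast
qed

text \<open>Uniqueness of the exponent is read off from the norm: h nonzero at 0 has nonzero norm
  there, since 0 is real, so an exponent j gives the norm of F the order 2 * j.\<close>

lemma real_multiplicity_zero_eq:
  assumes F: "\<And>l. sym (F l)" "\<And>q. q \<in> \<Omega> \<Longrightarrow> f q = stem_ext F q"
    and G: "\<And>l. sym (G l)" "\<And>l w. w \<in> D \<Longrightarrow> F l w = w ^ k * G l w" "stem_norm G 0 \<noteq> 0"
    and D0: "0 \<in> D"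
  shows "real_multiplicity \<Omega> f 0 = k"
proof -
  have \<Omega>0: "0 \<in> \<Omega>" using D0 of_real_mem_iff[of 0] by simp
  define P where "P = (\<lambda>m. \<exists>h\<in>slice_regular \<Omega>. h (of_real 0) \<noteq> 0 \<and> (\<forall>q\<in>\<Omega>. f q = (q - of_real 0) ^ m * h q))"
  have scale: "stem_ext (\<lambda>l w. w ^ j * H l w) q = q ^ j * stem_ext H q"
    if H: "\<And>l. sym (H l)" and q: "q \<in> \<Omega>" for H j q
  proof -
    obtain J z where Jz: "J \<in> imag_units" "z \<in> D" "q = slice_embed J z"
      using slice_embed_cases[OF q] .
    have "stem_ext (\<lambda>l w. w ^ j * H l w) q = slice_embed J (z ^ j) * stem_ext H q"
      unfolding Jz(3) by (rule stem_ext_scale[OF _ H _ Jz(1,2)]) (intro sym_intros H, rule refl)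
    then show ?thesis by (simp add: Jz(3) slice_embed_power[OF Jz(1)])
  qed
  have "stem_ext F q = q ^ k * stem_ext G q" if "q \<in> \<Omega>" for q
    using stem_ext_cong[of F "\<lambda>l w. w ^ k * G l w", OF F(1) _ _ that] scale[of G, OF G(1) that] G
    by (simp add: sym_intros)
  moreover have "stem_ext G 0 \<noteq> 0"
    using root_imp_stem_norm_zero[OF quat_i_imag_unit, of G 0] stem_ext_embed[of G, OF G(1) quat_i_imag_unit D0] G(3)
    by auto
  ultimately have "P k"
    unfolding P_def using stem_ext_regular[of G, OF G(1)] F(2) by (intro bexI[of _ "stem_ext G"]) auto
  moreover have "j = k" if "P j" for j
  proof -
    obtain h where h: "h \<in> slice_regular \<Omega>" "h 0 \<noteq> 0" "\<And>q. q \<in> \<Omega> \<Longrightarrow> f q = q ^ j * h q"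
      using \<open>P j\<close> unfolding P_def by auto
    obtain H where H: "\<And>l. sym (H l)" "\<And>q. q \<in> \<Omega> \<Longrightarrow> h q = stem_ext H q"
      using stem_exists[OF h(1)] by blast
    have FH: "F l w = w ^ j * H l w" if "w \<in> D" for l w
      by (rule stem_unique[of F "\<lambda>l w. w ^ j * H l w", OF F(1) _ _ that])
        (use F(2) h(3) H scale[of H, OF H(1)] in \<open>auto intro!: sym_intros\<close>)
    have "stem_norm H 0 \<noteq> 0"
    proof
      assume "stem_norm H 0 = 0"
      then have "H l 0 = 0" for l using stem_norm_real_zero[of H 0 l] H(1) D0 by simp
      then have "stem_ext H 0 = 0"
        using stem_ext_embed[of H, OF H(1) quat_i_imag_unit D0] by (simp add: quat_comb_def)
      then show False using h(2) H(2)[OF \<Omega>0] by simp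
    qed
    have "2 * j = 2 * k"
    proof (rule order_unique[where G = "stem_norm H" and H = "stem_norm G" and z = 0, OF open_D _ _ D0 \<open>stem_norm H 0 \<noteq> 0\<close> G(3)])
      show "stem_norm H holomorphic_on D" "stem_norm G holomorphic_on D"
        using sym_stem_norm H(1) G(1) sym_holomorphic by blast+
      fix w assume w: "w \<in> D"
      have "stem_norm F w = (w ^ j)\<^sup>2 * stem_norm H w" "stem_norm F w = (w ^ k)\<^sup>2 * stem_norm G w"
        by (rule stem_norm_scale, rule FH[OF w], rule stem_norm_scale, rule G(2)[OF w])
      then show "(w - 0) ^ (2 * j) * stem_norm H w = (w - 0) ^ (2 * k) * stem_norm G w"
        by (simp add: power_mult[symmetric] mult.commute)
    qed
    then show ?thesis by simp
  qed
  ultimately have "(THE m. P m) = k" by (rule the_equality)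
  then show ?thesis using \<Omega>0 by (simp add: real_multiplicity_def P_def)
qed

end

section \<open>Distributing the orders over the real and the nonreal points\<close>

theorem proposition3p1:
  fixes \<Omega> :: "quat set" and I\<^sub>0 :: quat and f :: "quat \<Rightarrow> quat" and m :: nat
  assumes "symmetric_slice_domain \<Omega>"
    and "I\<^sub>0 \<in> imag_units"
    and "simply_connected (\<Omega> \<inter> slice_plane I\<^sub>0)"
    and "f \<in> slice_regular \<Omega>"
    and "\<exists>q\<in>\<Omega>. f q \<noteq> 0"
    and "no_nonreal_isolated_zeros \<Omega> f"
    and "m = real_multiplicity \<Omega> f 0"
  shows "\<exists>R\<in>slice_preserving \<Omega>. \<exists>T\<in>slice_preserving \<Omega>. \<exists>h\<in>slice_regular \<Omega>.
           (\<forall>q\<in>\<Omega>. h q \<noteq> 0) \<and>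
           (\<forall>q\<in>\<Omega>. f q = q ^ m * R q * T q * h q) \<and>
           {q\<in>\<Omega>. R q = 0} = {q\<in>\<Omega>. q \<in> \<real> \<and> q \<noteq> 0 \<and> f q = 0} \<and>
           {q\<in>\<Omega>. T q = 0} = \<Union>{S. spherical_zero \<Omega> f S}"
proof -
  interpret slice_domain \<Omega> I\<^sub>0 using assms(1-3) by unfold_locales
  obtain F where F: "\<And>l. sym (F l)" "\<And>q. q \<in> \<Omega> \<Longrightarrow> f q = stem_ext F q"
    using stem_exists[OF assms(4)] by blast
  have f_embed: "f (slice_embed J z) = quat_comb (\<lambda>l. slice_embed J (F l z))"
    if "J \<in> imag_units" "z \<in> D" for J z
    using F(2) stem_ext_embed[of F, OF F(1) that] that by (simp add: slice_embed_mem_iff)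
  obtain l1 z1 where nz: "z1 \<in> D" "F l1 z1 \<noteq> 0"
  proof -
    obtain q where q: "q \<in> \<Omega>" "f q \<noteq> 0" using assms(5) by blast
    obtain J z where Jz: "J \<in> imag_units" "z \<in> D" "q = slice_embed J z"
      using slice_embed_cases[OF q(1)] .
    have "\<exists>l. F l z \<noteq> 0"
    proof (rule ccontr)
      assume "\<not> ?thesis"
      then have "f q = 0" using f_embed[OF Jz(1,2)] Jz(3) by (simp add: quat_comb_def)
      with q(2) show False by simp
    qed
    with Jz(2) that show thesis by blast
  qed
  have "\<forall>z\<in>D. \<exists>k G. (\<forall>l. sym (G l)) \<and> (\<forall>l. \<forall>w\<in>D. F l w = root_poly z w ^ k * G l w) \<and> stem_norm G z \<noteq> 0"
    using common_order[of F f, OF F nz assms(6)] by blast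
  then obtain k G where G: "\<And>z l. z \<in> D \<Longrightarrow> sym (G z l)"
    "\<And>z l w. z \<in> D \<Longrightarrow> w \<in> D \<Longrightarrow> F l w = root_poly z w ^ k z * G z l w"
    "\<And>z. z \<in> D \<Longrightarrow> stem_norm (G z) z \<noteq> 0"
    by metis

  have ordF: "\<exists>H. H holomorphic_on D \<and> (\<forall>w\<in>D. F l w = (w - z) ^ k z * H w)" if z: "z \<in> D" for l z
  proof -
    obtain r where "r holomorphic_on D" "\<And>w. root_poly z w = (w - z) * r w"
      using root_poly_factor by metis
    then show ?thesis
      using G(2)[OF z, of _ l] sym_holomorphic[OF G(1)[OF z, of l]]
      by (intro exI[of _ "\<lambda>w. r w ^ k z * G z l w"])
        (auto intro!: holomorphic_intros simp: power_mult_distrib)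
  qed
  \<comment> \<open>The norm is quadratic and its cofactor is nonzero at z, so its order is exactly
    twice the common order. This pins down k, which so far was only chosen pointwise.\<close>
  have ordN: "has_orders D (stem_norm F) (\<lambda>z. 2 * k z)"
    unfolding has_orders_def
  proof
    fix z assume z: "z \<in> D"
    obtain r where r: "r holomorphic_on D" "r z \<noteq> 0" "\<And>w. root_poly z w = (w - z) * r w"
      using root_poly_factor by metis
    have "stem_norm F w = (w - z) ^ (2 * k z) * ((r w ^ k z)\<^sup>2 * stem_norm (G z) w)" if "w \<in> D" for w
    proof -
      have "stem_norm F w = (root_poly z w ^ k z)\<^sup>2 * stem_norm (G z) w"
        by (rule stem_norm_scale) (rule G(2)[OF z that])
      then show ?thesis by (simp add: r(3) power_mult_distrib power_mult[symmetric] mult.commute)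
    qed
    moreover have "(\<lambda>w. (r w ^ k z)\<^sup>2 * stem_norm (G z) w) holomorphic_on D"
      using sym_holomorphic[OF sym_stem_norm[of "G z", OF G(1)[OF z]]] r(1) by (intro holomorphic_intros)
    ultimately show "\<exists>H. H holomorphic_on D \<and> H z \<noteq> 0 \<and> (\<forall>w\<in>D. stem_norm F w = (w - z) ^ (2 * k z) * H w)"
      using r(2) G(3)[OF z] by (intro exI[of _ "\<lambda>w. (r w ^ k z)\<^sup>2 * stem_norm (G z) w"]) auto
  qed
  have symN: "sym (stem_norm F)" by (rule sym_stem_norm) (rule F)
  have zero_iff: "stem_norm F z = 0 \<longleftrightarrow> k z \<noteq> 0" if "z \<in> D" for z
    using has_orders_zero_iff[OF ordN that] by simp
  have kF: "F l z = 0" if "z \<in> D" "k z \<noteq> 0" for l z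
    using G(2)[OF that(1,1)] that(2) by (simp add: power_0_left)
  \<comment> \<open>The exponents at z and at its conjugate were chosen independently; comparing the
    orders of the symmetric norm makes them equal.\<close>
  have k_cnj: "k (cnj z) = k z" if z: "z \<in> D" for z
  proof -
    obtain H where H: "H holomorphic_on D" "H z \<noteq> 0" "\<And>w. w \<in> D \<Longrightarrow> stem_norm F w = (w - z) ^ (2 * k z) * H w"
      using has_ordersE[OF ordN z] by blast
    obtain E where E: "E holomorphic_on D" "E (cnj z) \<noteq> 0"
      "\<And>w. w \<in> D \<Longrightarrow> stem_norm F w = (w - cnj z) ^ (2 * k (cnj z)) * E w"
      using has_ordersE[OF ordN cnj_D[OF z]] by blast
    have "2 * k (cnj z) = 2 * k z"
    proof (rule order_unique[OF open_D holomorphic_reflection[OF E(1)] H(1) z _ H(2)])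
      show "cnj (E (cnj z)) \<noteq> 0" using E(2) by simp
      fix w assume w: "w \<in> D"
      have "stem_norm F w = cnj (stem_norm F (cnj w))" using sym_cnj[OF symN w] by simp
      also have "\<dots> = (w - z) ^ (2 * k (cnj z)) * cnj (E (cnj w))"
        using E(3)[of "cnj w"] w by simp
      finally show "(w - z) ^ (2 * k (cnj z)) * cnj (E (cnj w)) = (w - z) ^ (2 * k z) * H w"
        using H(3)[OF w] by simp
    qed
    then show ?thesis by simp
  qed
  have fin: "finite {z\<in>L. k z \<noteq> 0}" if L: "compact L" "L \<subseteq> D" for L
  proof (cases "{z\<in>L. k z \<noteq> 0} = {}")
    case False
    then obtain z where "z \<in> D" "stem_norm F z = 0" using L zero_iff by blast
    moreover obtain z2 where "z2 \<in> D" "stem_norm F z2 \<noteq> 0"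
      using stem_norm_not_identically_zero[of F, OF F(1) nz] .
    ultimately have "\<not> stem_norm F constant_on D" unfolding constant_on_def by metis
    from holomorphic_compact_finite_zeros[OF sym_holomorphic[OF symN] open_D connected_D L this]
    show ?thesis by (rule finite_subset[rotated]) (use L zero_iff in auto)
  qed (simp only: finite.emptyI)
  have m: "m = k 0" if D0: "0 \<in> D"
    unfolding assms(7)
    by (rule real_multiplicity_zero_eq[of F f "G 0", OF F G(1)[OF D0] _ G(3)[OF D0] D0])
      (use G(2)[OF D0] in \<open>auto simp: root_poly_def\<close>)

  \<comment> \<open>The point 0 is left to \<open>q ^ m\<close>, because R must not vanish there.
    The orders still add up to k, since m = k 0 whenever 0 lies in D.\<close>
  define kR where "kR = (\<lambda>z. if z \<in> \<real> \<and> z \<noteq> 0 then k z else 0)"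
  define kT where "kT = (\<lambda>z. if z \<in> \<real> then 0 else k z)"
  have "finite {z\<in>L. kR z \<noteq> 0}" "finite {z\<in>L. kT z \<noteq> 0}" if L: "compact L" "L \<subseteq> D" for L
    by (rule finite_subset[OF _ fin[OF L]]; auto simp: kR_def kT_def)+
  note finRT = this
  have "kR (cnj z) = kR z" "kT (cnj z) = kT z" if "z \<in> D" for z
    using k_cnj[OF that] by (auto simp: kR_def kT_def complex_is_Real_iff)
  note cnjRT = this
  obtain R where R: "sym R" "has_orders D R kR"
    using symmetric_weierstrass[OF simply_connected_stem_domain finRT(1) cnjRT(1)] by blast
  obtain T where T: "sym T" "has_orders D T kT"
    using symmetric_weierstrass[OF simply_connected_stem_domain finRT(2) cnjRT(2)] by blast
  define M where "M = (\<lambda>z. z ^ m * R z * T z)"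
  have symM: "sym M" unfolding M_def by (intro sym_intros R T)
  have "has_orders D M (\<lambda>z. (if z = 0 then m else 0) + kR z + kT z)"
    unfolding M_def by (intro has_orders_mult has_orders_monomial R T)
  moreover have "(if z = 0 then m else 0) + kR z + kT z = k z" if "z \<in> D" for z
    using m that by (auto simp: kR_def kT_def)
  ultimately have M: "has_orders D M k" unfolding has_orders_def by simp
  have "\<exists>H. H holomorphic_on D \<and> (\<forall>w\<in>D. F l w = M w * H w)" for l
    by (rule holomorphic_quotient[OF open_D M ordF[of _ l]]) auto
  then obtain H where H: "\<And>l. H l holomorphic_on D" "\<And>l w. w \<in> D \<Longrightarrow> F l w = M w * H l w"
    by metis
  \<comment> \<open>\<open>M z1\<close> is nonzero because \<open>F l1 z1 = M z1 * H l1 z1\<close>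
    is.\<close>
  have symH: "sym (H l)" for l
    by (rule sym_quotient[OF F(1) symM H(1) nz(1) _ H(2)]) (use H(2)[OF nz(1)] nz(2) in auto)
  have nrmH: "stem_norm H z \<noteq> 0" if z: "z \<in> D" for z
  proof
    assume 0: "stem_norm H z = 0"
    obtain E where E: "E holomorphic_on D" "E z \<noteq> 0" "\<And>w. w \<in> D \<Longrightarrow> stem_norm F w = (w - z) ^ (2 * k z) * E w"
      using has_ordersE[OF ordN z] by blast
    obtain V where V: "V holomorphic_on D" "\<And>w. w \<in> D \<Longrightarrow> M w = (w - z) ^ k z * V w"
      using has_ordersE[OF M z] by blast
    \<comment> \<open>The norms of F and of M * H are compared after cancelling the power 2 * k z:
      the left side is nonzero, hence so is the norm of H.\<close>
    have "E z = (V z)\<^sup>2 * stem_norm H z"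
    proof (rule power_mult_left_cancel[OF open_D E(1) _ _ z, where H = "\<lambda>w. (V w)\<^sup>2 * stem_norm H w"])
      show "(\<lambda>w. (V w)\<^sup>2 * stem_norm H w) holomorphic_on D"
        using sym_holomorphic[OF sym_stem_norm[of H, OF symH]] V(1) by (intro holomorphic_intros)
      fix w assume w: "w \<in> D"
      have "stem_norm F w = (M w)\<^sup>2 * stem_norm H w" by (rule stem_norm_scale) (rule H(2)[OF w])
      then show "(w - z) ^ (2 * k z) * E w = (w - z) ^ (2 * k z) * ((V w)\<^sup>2 * stem_norm H w)"
        using E(3)[OF w] V(2)[OF w]
        by (simp only: power_mult_distrib power_mult[symmetric] mult.assoc mult.commute[of _ 2])
    qed
    with 0 E(2) show False by simp
  qed

  have vals: "stem_ext H q \<noteq> 0 \<and> f q = q ^ m * slice_ext R q * slice_ext T q * stem_ext H q" if q: "q \<in> \<Omega>" for q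
  proof
    obtain J z where Jz: "J \<in> imag_units" "z \<in> D" "q = slice_embed J z"
      using slice_embed_cases[OF q] .
    show "stem_ext H q \<noteq> 0"
      using root_imp_stem_norm_zero[OF Jz(1), of H z] nrmH[OF Jz(2)] stem_ext_embed[of H, OF symH Jz(1,2)] Jz(3)
      by auto
    have "f q = slice_embed J (M z) * stem_ext H q"
      unfolding F(2)[OF q] unfolding Jz(3) by (rule stem_ext_scale[where F = F and G = H, OF F(1) symH H(2)[OF Jz(2)] Jz(1,2)])
    then show "f q = q ^ m * slice_ext R q * slice_ext T q * stem_ext H q"
      using Jz by (simp add: M_def slice_embed_mult slice_embed_power slice_ext_embed R(1) T(1))
  qed
  have R_zeros: "{q\<in>\<Omega>. slice_ext R q = 0} = {q\<in>\<Omega>. q \<in> \<real> \<and> q \<noteq> 0 \<and> f q = 0}"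
  proof (intro Collect_cong conj_cong refl)
    fix q assume q: "q \<in> \<Omega>"
    obtain J z where Jz: "J \<in> imag_units" "z \<in> D" "q = slice_embed J z"
      using slice_embed_cases[OF q] .
    \<comment> \<open>A zero at one point of the sphere kills the norm, and by the exact order of
      the norm all stem functions vanish at z.\<close>
    have "f q = 0 \<longleftrightarrow> k z \<noteq> 0"
    proof
      assume "f q = 0"
      then have "stem_norm F z = 0"
        using f_embed[OF Jz(1,2)] Jz(3) by (intro root_imp_stem_norm_zero[OF Jz(1)]) simp
      then show "k z \<noteq> 0" using zero_iff[OF Jz(2)] by simp
    next
      assume "k z \<noteq> 0"
      then have "F l z = 0" for l by (rule kF[OF Jz(2)])
      then show "f q = 0" using f_embed[OF Jz(1,2)] Jz(3) by (simp add: quat_comb_def)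
    qed
    then show "slice_ext R q = 0 \<longleftrightarrow> q \<in> \<real> \<and> q \<noteq> 0 \<and> f q = 0"
      using Jz has_orders_zero_iff[OF R(2) Jz(2)] slice_ext_embed[OF R(1) Jz(1,2)]
      by (simp add: slice_embed_eq_0_iff slice_embed_real_iff kR_def)
  qed
  have T_zeros: "{q\<in>\<Omega>. slice_ext T q = 0} = \<Union>{S. spherical_zero \<Omega> f S}"
  proof -
    have T_zero: "slice_ext T (slice_embed J z) = 0 \<longleftrightarrow> z \<notin> \<real> \<and> k z \<noteq> 0"
      if "J \<in> imag_units" "z \<in> D" for J z
      using that has_orders_zero_iff[OF T(2) that(2)] slice_ext_embed[OF T(1) that]
      by (simp add: slice_embed_eq_0_iff kT_def)
    show ?thesis
    proof (intro equalityI subsetI)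
      fix q assume "q \<in> {q\<in>\<Omega>. slice_ext T q = 0}"
      then have q: "q \<in> \<Omega>" "slice_ext T q = 0" by auto
      obtain J z where Jz: "J \<in> imag_units" "z \<in> D" "q = slice_embed J z"
        using slice_embed_cases[OF q(1)] .
      then have z: "Im z \<noteq> 0" "k z \<noteq> 0"
        using q(2) T_zero by (auto simp: complex_is_Real_iff)
      have "stem_ext (G z) p \<noteq> 0" if p: "p \<in> quat_sphere (Re z) (Im z)" for p
      proof -
        obtain K where "K \<in> imag_units" "p = slice_embed K z"
          using p by (auto simp: quat_sphere_eq)
        then show ?thesis
          using root_imp_stem_norm_zero[of K "G z" z] G(3)[OF Jz(2)]
            stem_ext_embed[of "G z" K z, OF G(1)[OF Jz(2)]] Jz(2) by auto
      qed
      \<comment> \<open>No linear factors are needed: the norm of \<open>G z\<close> is nonzero at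
        z, so its extension has no zero on the sphere.\<close>
      then have "sphere_factorization \<Omega> f (Re z) (Im z) (k z) [] (stem_ext (G z))"
        by (intro sphere_factorizationI[of F f "G z", OF F G(1)[OF Jz(2)] G(2)[OF Jz(2)] Jz(2) z(1)]
            stem_ext_regular[of "G z", OF G(1)[OF Jz(2)]]) auto
      then have "spherical_zero \<Omega> f (quat_sphere (Re z) (Im z))"
        unfolding spherical_zero_def using z(2) by (metis One_nat_def Suc_leI neq0_conv)
      moreover have "q \<in> quat_sphere (Re z) (Im z)"
        using Jz by (auto simp: quat_sphere_eq)
      ultimately show "q \<in> \<Union>{S. spherical_zero \<Omega> f S}" by blast
    next
      fix q assume "q \<in> \<Union>{S. spherical_zero \<Omega> f S}"
      then obtain \<alpha> \<beta> \<mu> ps g where q: "q \<in> quat_sphere \<alpha> \<beta>" and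
        fac: "sphere_factorization \<Omega> f \<alpha> \<beta> \<mu> ps g" and \<mu>: "\<mu> \<ge> 1"
        unfolding spherical_zero_def by blast
      define z where "z = Complex \<alpha> \<beta>"
      have z: "Im z \<noteq> 0" and sub: "quat_sphere \<alpha> \<beta> \<subseteq> \<Omega>"
        using fac by (auto simp: sphere_factorization_def z_def)
      obtain J where J: "J \<in> imag_units" "q = slice_embed J z"
        using q by (auto simp: quat_sphere_eq z_def)
      then have zD: "z \<in> D" using q sub slice_embed_mem_iff by blast
      have "f (slice_embed K z) = 0" if K: "K \<in> imag_units" for K
      proof -
        have "(slice_embed K z - of_real \<alpha>)\<^sup>2 + of_real (\<beta>\<^sup>2) = 0"
          using slice_embed_root_poly[OF K z, of z] by (simp add: z_def)
        moreover have "slice_embed K z \<in> \<Omega>" using K zD slice_embed_mem_iff by blast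
        ultimately show ?thesis
          using fac \<mu> by (simp add: sphere_factorization_def power_0_left)
      qed
      \<comment> \<open>Vanishing on the whole sphere, rather than at one point, forces every
        component to vanish.\<close>
      then have "F l z = 0" for l
        using f_embed[OF _ zD] by (intro all_roots_imp_zero) simp
      then have "k z \<noteq> 0" using zero_iff[OF zD] by (simp add: stem_norm_def)
      then show "q \<in> {q\<in>\<Omega>. slice_ext T q = 0}"
        using T_zero[OF J(1) zD] z J q sub by (auto simp: complex_is_Real_iff)
    qed
  qed
  show ?thesis
  proof (rule bexI[of _ "slice_ext R"], rule bexI[of _ "slice_ext T"], rule bexI[of _ "stem_ext H"], intro conjI)
    show "\<forall>q\<in>\<Omega>. stem_ext H q \<noteq> 0" "\<forall>q\<in>\<Omega>. f q = q ^ m * slice_ext R q * slice_ext T q * stem_ext H q"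
      using vals by blast+
  qed (rule R_zeros T_zeros slice_ext_preserving stem_ext_regular R(1) T(1) symH)+
qed

end
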